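(* The semidiscretized magneto-quasistatic system $$\tfrac{\rm d}{{\rm d}t}\mathcal{E}_{\rm FE}\,x_{\rm FE}=\mathcal{A}_{\rm FE}(x_{\rm FE})\,x_{\rm FE}+\mathcal{B}_{\rm FE}\,u,\qquad \mathcal{E}_{\rm FE}\,x_{\rm FE}(0)=\mathcal{E}_{\rm FE}\,x_{\rm FE,0},\qquad y_{\rm FE}=\mathcal{B}_{\rm FE}^T\,x_{\rm FE},$$ with state $x_{\rm FE}=[a^T,\boldsymbol{i}^T]^T\in\mathbb{R}^{n_e+m}$, input $u=\boldsymbol{v}$, output $y_{\rm FE}=\boldsymbol{i}$ and $$\mathcal{E}_{\rm FE}=\begin{bmatrix}M_\sigma&0\\ X^T&0\end{bmatrix},\qquad \mathcal{A}_{\rm FE}(x_{\rm FE})=\begin{bmatrix}-K(a)&X\\ 0&-R\end{bmatrix},\qquad \mathcal{B}_{\rm FE}=\begin{bmatrix}0\\ I\end{bmatrix},$$ is passive.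
   Context: All spaces are real; $\|\cdot\|$ is the Euclidean norm. Domain and data. $\Omega\subset\mathbb{R}^3$ is a simply connected bounded Lipschitz domain, decomposed into a conducting subdomain $\Omega_C$ (connected, $\overline{\Omega}_C\subset\Omega$) and a non-conducting subdomain $\Omega_I=\Omega\setminus\overline{\Omega}_C$; $\Omega_I$ has finitely many connected internal subdomains with single boundary components $\Gamma_1,\ldots,\Gamma_q$ and an external subdomain $\Omega_{I,\rm ext}$ with two boundary components $\Gamma_{\rm ext}=\overline{\Omega}_{I,\rm ext}\cap\overline{\Omega}_C$ and $\partial\Omega$. The conductivity is $\sigma=\sigma_C\mathbb{1}_{\Omega_C}$ with $\sigma_C>0$. The reluctivity is $\nu(\xi,\zeta)=\nu_C(\zeta)\mathbb{1}_{\Omega_C}(\xi)+\nu_I\mathbb{1}_{\Omega_I}(\xi)$, where $\nu_I>0$ and $\nu_C:\mathbb{R}_{\ge0}\to\mathbb{R}_{\ge0}$ is measurable, and $\zeta\mapsto\nu_C(\zeta)\zeta$ is strongly monotone with constant $m_{\nu_C}>0$ and Lipschitz continuous with constant $L_{\nu_C}>0$. The resistance matrix $R\in\mathbb{R}^{m\times m}$ is symmetric positive definite. The winding function $\chi=[\chi_1,\ldots,\chi_m]$ has columns $\chi_j\in L^2(\Omega;\mathbb{R}^3)$ with $\nabla\cdot\chi_j=0$ and pairwise disjoint supports. FEM matrices. $\varphi_1^e,\ldots,\varphi_{n_e}^e\in H_0(\mathrm{curl},\Omega)$ are the edge (Nédélec, first type) basis functions of a regular simplicial triangulation of $\Omega$.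 For $a=[\alpha_1^e,\ldots,\alpha_{n_e}^e]^T$ put $(M_\sigma)_{kl}=\int_\Omega\sigma\,\varphi_l^e\cdot\varphi_k^e\,{\rm d}\xi$, $(K(a))_{kl}=\int_\Omega\nu(\xi,\|\nabla\times\sum_j\alpha_j^e\varphi_j^e\|)(\nabla\times\varphi_l^e)\cdot(\nabla\times\varphi_k^e)\,{\rm d}\xi$, $X_{kj}=\int_\Omega\chi_j\cdot\varphi_k^e\,{\rm d}\xi$. $M_\sigma$ and $K(a)$ are symmetric positive semidefinite. Ordering the basis functions according to the conducting and non-conducting subdomains, $a=[a_1^T,a_2^T]^T$, $$M_\sigma=\begin{bmatrix}M_{11}&0\\ 0&0\end{bmatrix},\quad K(a)=\begin{bmatrix}K_{11}(a_1)&K_{12}\\ K_{21}&K_{22}\end{bmatrix},\quad X=\begin{bmatrix}X_1\\ X_2\end{bmatrix},$$ where $M_{11}$ is symmetric positive definite, only $K_{11}(a_1)$ depends on $a$, and $X_2$ has full column rank. The initial vector is $x_{\rm FE,0}=[a_0^T,0]^T$. Passivity. For a control system $\tfrac{\rm d}{{\rm d}t}Ex=A(x)+Bu$, $Ex(0)=Ex_0$, with output $y$, state space $\mathcal{X}=\mathbb{R}^n$ and input/output space $\mathbb{R}^m$, an input $u\in L^2([0,T];\mathbb{R}^m)$ is admissible with the initial condition $Ex(0)=Ex_0$ if the initial value problem has a solution $x:[0,T]\to\mathcal{X}$ such that the state equation holds in the sense of weak derivatives (in particular, $x$ is continuous) and $y\in L^2([0,T];\mathbb{R}^m)$. A function $\mathcal{S}:\mathcal{X}\to\mathbb{R}_{\ge0}\cup\{\infty\}$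 is a storage function for passivity if for all $T>0$, all $x_0\in\mathcal{X}$ with $\mathcal{S}(x_0)<\infty$ and all inputs $u\in L^2([0,T];\mathbb{R}^m)$ admissible with $Ex(0)=Ex_0$: (a) $t\mapsto\mathcal{S}(x(t))$ is continuous from $[0,T]$ to $\mathbb{R}_{\ge0}\cup\{\infty\}$; (b) for all $0\le t_0\le t_1\le T$, $\mathcal{S}(x(t_1))-\mathcal{S}(x(t_0))\le\int_{t_0}^{t_1}u(\tau)^Ty(\tau)\,{\rm d}\tau$. The system is passive if there exists a storage function for passivity. *)

theory Defs
  imports "HOL-Analysis.Analysis"
begin

section \<open>Function spaces and differential operators\<close>

definition L2_on :: "'a::euclidean_space set \<Rightarrow> ('a \<Rightarrow> 'b::euclidean_space) \<Rightarrow> bool" where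
  "L2_on S f \<longleftrightarrow> set_borel_measurable lebesgue S f \<and>
     set_integrable lebesgue S (\<lambda>x. (norm (f x))\<^sup>2)"

primrec partials ::
  "'a::euclidean_space list \<Rightarrow> ('a \<Rightarrow> 'b::real_normed_vector) \<Rightarrow> 'a \<Rightarrow> 'b" where
  "partials [] f = f"
| "partials (b # bs) f = (\<lambda>x. frechet_derivative (partials bs f) (at x) b)"

definition smooth :: "('a::euclidean_space \<Rightarrow> 'b::real_normed_vector) \<Rightarrow> bool" where
  "smooth f \<longleftrightarrow> (\<forall>bs. set bs \<subseteq> Basis \<longrightarrow> (\<forall>x. partials bs f differentiable (at x)))"

definition test_function ::
  "'a::euclidean_space set \<Rightarrow> ('a \<Rightarrow> 'b::real_normed_vector) \<Rightarrow> bool" where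
  "test_function S \<psi> \<longleftrightarrow> smooth \<psi> \<and> (\<exists>C. compact C \<and> C \<subseteq> S \<and> (\<forall>x. x \<notin> C \<longrightarrow> \<psi> x = 0))"

definition grad :: "('a::euclidean_space \<Rightarrow> real) \<Rightarrow> 'a \<Rightarrow> 'a" where
  "grad f x = (\<Sum>b\<in>Basis. frechet_derivative f (at x) b *\<^sub>R b)"

definition partial_comp :: "3 \<Rightarrow> 3 \<Rightarrow> (real^3 \<Rightarrow> real^3) \<Rightarrow> real^3 \<Rightarrow> real" where
  "partial_comp i j f x = frechet_derivative f (at x) (axis i 1) $ j"

text \<open>Pointwise curl; for the fields below it is meaningful almost everywhere, namely in the
  open tetrahedra of the mesh.\<close>

definition curl :: "(real^3 \<Rightarrow> real^3) \<Rightarrow> real^3 \<Rightarrow> real^3" where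
  "curl f x = vector [partial_comp 2 3 f x - partial_comp 3 2 f x,
                      partial_comp 3 1 f x - partial_comp 1 3 f x,
                      partial_comp 1 2 f x - partial_comp 2 1 f x]"

text \<open>\<open>f\<close> lies in the closure of the compactly supported smooth fields with respect to the
  graph norm of the curl, and \<open>w\<close> is its weak curl.\<close>

definition H0_curl :: "(real^3) set \<Rightarrow> (real^3 \<Rightarrow> real^3) \<Rightarrow> (real^3 \<Rightarrow> real^3) \<Rightarrow> bool" where
  "H0_curl \<Omega> f w \<longleftrightarrow> L2_on \<Omega> f \<and> L2_on \<Omega> w \<and>
     (\<exists>\<psi>. (\<forall>n::nat. test_function \<Omega> (\<psi> n)) \<and>
        (\<lambda>n. LINT x:\<Omega>|lebesgue. (norm (\<psi> n x - f x))\<^sup>2) \<longlonglongrightarrow> 0 \<and>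
        (\<lambda>n. LINT x:\<Omega>|lebesgue. (norm (curl (\<psi> n) x - w x))\<^sup>2) \<longlonglongrightarrow> 0)"

definition weakly_divergence_free :: "(real^3) set \<Rightarrow> (real^3 \<Rightarrow> real^3) \<Rightarrow> bool" where
  "weakly_divergence_free \<Omega> f \<longleftrightarrow>
     (\<forall>\<psi>. test_function \<Omega> \<psi> \<longrightarrow> (LINT x:\<Omega>|lebesgue. f x \<bullet> grad \<psi> x) = 0)"

definition ess_support :: "(real^3) set \<Rightarrow> (real^3 \<Rightarrow> real^3) \<Rightarrow> (real^3) set" where
  "ess_support \<Omega> f = {x \<in> \<Omega>. \<forall>r>0. \<not> (AE z in lebesgue. z \<in> \<Omega> \<inter> ball x r \<longrightarrow> f z = 0)}"

definition locally_integrable :: "real set \<Rightarrow> (real \<Rightarrow> 'b::euclidean_space) \<Rightarrow> bool" where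
  "locally_integrable I f \<longleftrightarrow> (\<forall>C. compact C \<and> C \<subseteq> I \<longrightarrow> set_integrable lebesgue C f)"

definition has_weak_derivative ::
  "real set \<Rightarrow> (real \<Rightarrow> 'b::euclidean_space) \<Rightarrow> (real \<Rightarrow> 'b) \<Rightarrow> bool" where
  "has_weak_derivative I z f \<longleftrightarrow> locally_integrable I z \<and> locally_integrable I f \<and>
     (\<forall>\<psi>::real \<Rightarrow> real. test_function I \<psi> \<longrightarrow>
        (LINT t:I|lebesgue. deriv \<psi> t *\<^sub>R z t) = - (LINT t:I|lebesgue. \<psi> t *\<^sub>R f t))"


section \<open>Passivity of control systems\<close>

text \<open>The system is \<open>d/dt (E x) = A x + B u\<close> with a nonlinear map \<open>A\<close> and output \<open>y = h x\<close>.\<close>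

definition solution ::
  "real^'n^'n \<Rightarrow> (real^'n \<Rightarrow> real^'n) \<Rightarrow> real^'m^'n \<Rightarrow>
   real \<Rightarrow> real^'n \<Rightarrow> (real \<Rightarrow> real^'m) \<Rightarrow> (real \<Rightarrow> real^'n) \<Rightarrow> bool" where
  "solution E A B T x0 u x \<longleftrightarrow>
     continuous_on {0..T} x \<and> E *v x 0 = E *v x0 \<and>
     has_weak_derivative {0<..<T} (\<lambda>t. E *v x t) (\<lambda>t. A (x t) + B *v u t)"

text \<open>The difference is taken in the extended reals, where \<open>\<infinity> - \<infinity> = \<infinity>\<close>; hence the dissipation
  inequality forces the storage to be finite along the trajectory.\<close>

definition storage_function ::
  "real^'n^'n \<Rightarrow> (real^'n \<Rightarrow> real^'n) \<Rightarrow> real^'m^'n \<Rightarrow> (real^'n \<Rightarrow> real^'m) \<Rightarrow>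
   (real^'n \<Rightarrow> ennreal) \<Rightarrow> bool" where
  "storage_function E A B h S \<longleftrightarrow>
     (\<forall>T>0. \<forall>x0 u x. S x0 < \<infinity> \<and> L2_on {0..T} u \<and> solution E A B T x0 u x \<and>
         L2_on {0..T} (\<lambda>t. h (x t)) \<longrightarrow>
       continuous_on {0..T} (\<lambda>t. S (x t)) \<and>
       (\<forall>t0 t1. 0 \<le> t0 \<and> t0 \<le> t1 \<and> t1 \<le> T \<longrightarrow>
          enn2ereal (S (x t1)) - enn2ereal (S (x t0))
            \<le> ereal (LINT t:{t0..t1}|lebesgue. u t \<bullet> h (x t))))"

text \<open>The function with constant value \<open>\<infinity>\<close> meets the requirements on a storage function
  vacuously, for every system. Passivity therefore asks for a proper one.\<close>

definition is_passive ::
  "real^'n^'n \<Rightarrow> (real^'n \<Rightarrow> real^'n) \<Rightarrow> real^'m^'n \<Rightarrow> (real^'n \<Rightarrow> real^'m) \<Rightarrow> bool" where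
  "is_passive E A B h \<longleftrightarrow> (\<exists>S. storage_function E A B h S \<and> (\<exists>x. S x < \<infinity>))"


section \<open>Domain and data\<close>

text \<open>Near each boundary point the set is the strict epigraph, in direction \<open>d\<close>, of a Lipschitz
  function of the component orthogonal to \<open>d\<close>.\<close>

definition lipschitz_boundary :: "'a::euclidean_space set \<Rightarrow> bool" where
  "lipschitz_boundary \<Omega> \<longleftrightarrow>
     (\<forall>p \<in> frontier \<Omega>. \<exists>r>0. \<exists>d L g. norm d = 1 \<and> L-lipschitz_on UNIV g \<and>
        \<Omega> \<inter> ball p r = {x \<in> ball p r. g (x - (x \<bullet> d) *\<^sub>R d) < x \<bullet> d})"

definition bounded_lipschitz_domain :: "'a::euclidean_space set \<Rightarrow> bool" where
  "bounded_lipschitz_domain \<Omega> \<longleftrightarrow>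
     open \<Omega> \<and> connected \<Omega> \<and> \<Omega> \<noteq> {} \<and> bounded \<Omega> \<and> lipschitz_boundary \<Omega>"

definition conducting_decomposition ::
  "(real^3) set \<Rightarrow> (real^3) set \<Rightarrow> (real^3) set \<Rightarrow> bool" where
  "conducting_decomposition \<Omega> \<Omega>C \<Omega>I \<longleftrightarrow>
     open \<Omega>C \<and> connected \<Omega>C \<and> \<Omega>C \<noteq> {} \<and> closure \<Omega>C \<subseteq> \<Omega> \<and> \<Omega>I = \<Omega> - closure \<Omega>C \<and>
     finite (components \<Omega>I) \<and>
     (\<exists>\<Omega>ext \<in> components \<Omega>I.
        components (frontier \<Omega>ext) = {closure \<Omega>ext \<inter> closure \<Omega>C, frontier \<Omega>} \<and>
        (\<forall>D \<in> components \<Omega>I - {\<Omega>ext}. connected (frontier D)))"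

definition conductivity :: "(real^3) set \<Rightarrow> real \<Rightarrow> real^3 \<Rightarrow> real" where
  "conductivity \<Omega>C \<sigma>C \<xi> = \<sigma>C * indicator \<Omega>C \<xi>"

definition reluctivity ::
  "(real^3) set \<Rightarrow> (real^3) set \<Rightarrow> (real \<Rightarrow> real) \<Rightarrow> real \<Rightarrow> real^3 \<Rightarrow> real \<Rightarrow> real" where
  "reluctivity \<Omega>C \<Omega>I \<nu>C \<nu>I \<xi> \<zeta> = \<nu>C \<zeta> * indicator \<Omega>C \<xi> + \<nu>I * indicator \<Omega>I \<xi>"

definition strongly_monotone_on :: "real \<Rightarrow> real set \<Rightarrow> (real \<Rightarrow> real) \<Rightarrow> bool" where
  "strongly_monotone_on m S f \<longleftrightarrow>
     (\<forall>x\<in>S. \<forall>y\<in>S. m * (x - y)\<^sup>2 \<le> (f x - f y) * (x - y))"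

definition sym_pos_def :: "real^'n^'n \<Rightarrow> bool" where
  "sym_pos_def A \<longleftrightarrow> transpose A = A \<and> (\<forall>x. x \<noteq> 0 \<longrightarrow> 0 < x \<bullet> (A *v x))"

definition winding_function :: "(real^3) set \<Rightarrow> ('m \<Rightarrow> real^3 \<Rightarrow> real^3) \<Rightarrow> bool" where
  "winding_function \<Omega> ch \<longleftrightarrow>
     (\<forall>j. L2_on \<Omega> (ch j) \<and> weakly_divergence_free \<Omega> (ch j)) \<and>
     (\<forall>i j. i \<noteq> j \<longrightarrow> ess_support \<Omega> (ch i) \<inter> ess_support \<Omega> (ch j) = {})"


section \<open>Edge elements\<close>

definition regular_tetrahedral_mesh :: "(real^3) set \<Rightarrow> (real^3) set set \<Rightarrow> bool" where
  "regular_tetrahedral_mesh \<Omega> \<T> \<longleftrightarrow>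
     triangulation \<T> \<and> (\<forall>T\<in>\<T>. 3 simplex T) \<and> \<Union>\<T> = closure \<Omega>"

definition edge_moment :: "real^3 \<Rightarrow> real^3 \<Rightarrow> (real^3 \<Rightarrow> real^3) \<Rightarrow> real" where
  "edge_moment v w f = integral {0..1} (\<lambda>s. f (linepath v w s) \<bullet> (w - v))"

text \<open>Lowest-order first-type elements: on each tetrahedron the fields have the form
  \<open>\<xi> \<mapsto> \<alpha> + \<beta> \<times> \<xi>\<close>, and the degrees of freedom are the tangential line integrals along the
  edges. The basis functions are dual to those of the edges not contained in the boundary; the
  edge with index \<open>k\<close> is oriented from \<open>p k\<close> to \<open>q k\<close>. Values on the faces of the mesh, a null
  set on which only the tangential trace is single-valued, are left open.\<close>

definition nedelec_edge_basis ::
  "(real^3) set \<Rightarrow> (real^3) set set \<Rightarrow> ('e \<Rightarrow> real^3) \<Rightarrow> ('e \<Rightarrow> real^3) \<Rightarrow>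
   ('e \<Rightarrow> real^3 \<Rightarrow> real^3) \<Rightarrow> bool" where
  "nedelec_edge_basis \<Omega> \<T> p q \<phi> \<longleftrightarrow>
     bij_betw (\<lambda>k. closed_segment (p k) (q k)) UNIV
       {e. (\<exists>T\<in>\<T>. e edge_of T) \<and> \<not> e \<subseteq> frontier \<Omega>} \<and>
     (\<forall>k. H0_curl \<Omega> (\<phi> k) (curl (\<phi> k))) \<and>
     (\<forall>k. \<forall>T\<in>\<T>. \<exists>\<alpha> \<beta>.
        (\<forall>\<xi> \<in> interior T. \<phi> k \<xi> = \<alpha> + cross3 \<beta> \<xi>) \<and>
        (closed_segment (p k) (q k) edge_of T \<longrightarrow>
           edge_moment (p k) (q k) (\<lambda>\<xi>. \<alpha> + cross3 \<beta> \<xi>) = 1) \<and>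
        (\<forall>v w. closed_segment v w edge_of T \<and>
             closed_segment v w \<noteq> closed_segment (p k) (q k) \<longrightarrow>
           edge_moment v w (\<lambda>\<xi>. \<alpha> + cross3 \<beta> \<xi>) = 0))"

text \<open>The left summand of the index type enumerates the basis functions that do not vanish on
  the conductor, the right summand those that do.\<close>

definition conductor_ordering ::
  "(real^3) set \<Rightarrow> ('c + 'd \<Rightarrow> real^3 \<Rightarrow> real^3) \<Rightarrow> bool" where
  "conductor_ordering \<Omega>C \<phi> \<longleftrightarrow>
     (\<forall>k. \<not> (AE \<xi> in lebesgue. \<xi> \<in> \<Omega>C \<longrightarrow> \<phi> (Inl k) \<xi> = 0)) \<and>
     (\<forall>k. AE \<xi> in lebesgue. \<xi> \<in> \<Omega>C \<longrightarrow> \<phi> (Inr k) \<xi> = 0)"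

definition mass_matrix ::
  "(real^3) set \<Rightarrow> (real^3 \<Rightarrow> real) \<Rightarrow> ('e::finite \<Rightarrow> real^3 \<Rightarrow> real^3) \<Rightarrow> real^'e^'e" where
  "mass_matrix \<Omega> \<sigma> \<phi> = (\<chi> k l. LINT \<xi>:\<Omega>|lebesgue. \<sigma> \<xi> * (\<phi> l \<xi> \<bullet> \<phi> k \<xi>))"

definition stiffness_matrix ::
  "(real^3) set \<Rightarrow> (real^3 \<Rightarrow> real \<Rightarrow> real) \<Rightarrow> ('e::finite \<Rightarrow> real^3 \<Rightarrow> real^3) \<Rightarrow>
   real^'e \<Rightarrow> real^'e^'e" where
  "stiffness_matrix \<Omega> \<nu> \<phi> a = (\<chi> k l. LINT \<xi>:\<Omega>|lebesgue.
     \<nu> \<xi> (norm (curl (\<lambda>\<eta>. \<Sum>j\<in>UNIV. (a $ j) *\<^sub>R \<phi> j \<eta>) \<xi>)) * (curl (\<phi> l) \<xi> \<bullet> curl (\<phi> k) \<xi>))"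

definition winding_matrix ::
  "(real^3) set \<Rightarrow> ('m::finite \<Rightarrow> real^3 \<Rightarrow> real^3) \<Rightarrow> ('e::finite \<Rightarrow> real^3 \<Rightarrow> real^3) \<Rightarrow>
   real^'m^'e" where
  "winding_matrix \<Omega> ch \<phi> = (\<chi> k j. LINT \<xi>:\<Omega>|lebesgue. ch j \<xi> \<bullet> \<phi> k \<xi>)"


section \<open>The semidiscretized system\<close>

definition block_matrix ::
  "real^'c^'a \<Rightarrow> real^'d^'a \<Rightarrow> real^'c^'b \<Rightarrow> real^'d^'b \<Rightarrow> real^('c + 'd)^('a + 'b)" where
  "block_matrix P Q U V = (\<chi> i j. case i of
      Inl k \<Rightarrow> (case j of Inl l \<Rightarrow> P $ k $ l | Inr l \<Rightarrow> Q $ k $ l)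
    | Inr k \<Rightarrow> (case j of Inl l \<Rightarrow> U $ k $ l | Inr l \<Rightarrow> V $ k $ l))"

definition upper_part :: "real^('a::finite + 'b::finite) \<Rightarrow> real^'a" where
  "upper_part x = (\<chi> k. x $ Inl k)"

definition E_FE :: "real^'e^'e \<Rightarrow> real^'m^'e \<Rightarrow> real^('e + 'm)^('e + 'm)" where
  "E_FE M X = block_matrix M 0 (transpose X) 0"

definition A_FE ::
  "(real^'e \<Rightarrow> real^'e^'e) \<Rightarrow> real^'m^'e \<Rightarrow> real^'m^'m \<Rightarrow>
   real^('e + 'm) \<Rightarrow> real^('e + 'm)^('e + 'm)" where
  "A_FE K X R x = block_matrix (- K (upper_part x)) X 0 (- R)"

definition B_FE :: "real^'m^('e::finite + 'm::finite)" where
  "B_FE = (\<chi> i j. case i of Inl k \<Rightarrow> 0 | Inr k \<Rightarrow> mat 1 $ k $ j)"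

definition upper_left_block :: "real^('a::finite + 'b::finite)^('a + 'b) \<Rightarrow> real^'a^'a" where
  "upper_left_block P = (\<chi> k l. P $ Inl k $ Inl l)"

definition lower_rows :: "real^'m^('a::finite + 'b::finite) \<Rightarrow> real^'m^'b" where
  "lower_rows P = (\<chi> k j. P $ Inr k $ j)"

end

theory Submission
  imports Defs
begin

text \<open>
  The storage function is the magnetic energy \<open>W a = \<integral>\<^bsub>\<Omega>\<^esub> \<theta>(\<xi>, \<parallel>curl a\<parallel>) d\<xi>\<close> with
  \<open>\<theta>(\<xi>, \<rho>) = \<integral>\<^bsub>0\<^esub>\<^bsup>\<rho>\<^esup> \<nu>(\<xi>, \<zeta>) \<zeta> d\<zeta>\<close>. Its gradient is \<open>K(a) a\<close>, so a differentiable trajectory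
  would satisfy
  \<open>dW/dt = K(a) a \<bullet> a' = - a' \<bullet> M a' + i \<bullet> (X\<^sup>T a)' = - a' \<bullet> M a' - i \<bullet> R i + i \<bullet> v \<le> i \<bullet> v\<close>.
  A solution, however, is merely continuous: only \<open>E x = (M a, X\<^sup>T a)\<close> has a weak derivative, and
  \<open>M\<close> may be singular, so that \<open>a'\<close> is not available.

  The proof therefore works with increments. The map \<open>\<zeta> \<mapsto> \<nu>(\<zeta>) \<zeta>\<close> is nondecreasing, which makes
  \<open>W\<close> convex, and the subgradient inequality (\<open>energy_subgradient\<close>) yields
  \<open>W(a(t)) - W(a(s)) \<le> K(a(t)) a(t) \<bullet> (a(t) - a(s))\<close>. The right-hand side sees the
  increment of \<open>a\<close> only through that of \<open>E x\<close>. Indeed \<open>h = K(a) a - X i\<close> is minus the derivative of \<open>M a\<close>; it is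
  continuous in time and takes values in the range of \<open>M\<close>, hence \<open>h = M q\<close> with a continuous \<open>q\<close>.
  The costate \<open>p = (q, i)\<close> then satisfies \<open>E\<^sup>T p = (K(a) a, 0)\<close>, and the bound becomes
  \<open>p(t) \<bullet> (E x(t) - E x(s)) = p(t) \<bullet> \<integral>\<^bsub>s\<^esub>\<^bsup>t\<^esup> f\<close>, where \<open>f = (- h, v - R i)\<close> is the weak derivative of
  \<open>E x\<close>. Adding these bounds over finer and finer partitions gives
  \<open>W(a(t\<^sub>1)) - W(a(t\<^sub>0)) \<le> \<integral> p \<bullet> f\<close>, and \<open>p \<bullet> f = - q \<bullet> M q - i \<bullet> R i + i \<bullet> v \<le> i \<bullet> v\<close>.

  Four ingredients carry this. The increments of a continuous function with integrable weak
  derivative are the integrals of that derivative (\<open>weak_derivative_increment\<close>, which rests on explicit test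
  functions). The passage from increments to the integral is \<open>increment_le_integral_inner\<close>.
  Both are combined with the algebra of the system in \<open>passive_if_convex_energy\<close>, for any convex
  energy whose gradient \<open>K(a) a\<close> is continuous in \<open>a\<close>. Finally, the finite element energy is of
  this kind (locale \<open>magnetic_energy\<close>), because almost every point lies inside a tetrahedron, where
  the curl of a combination of basis functions is the combination of their curls.
\<close>

section \<open>Smooth steps\<close>

text \<open>Smoothness of real functions in a form suited to induction on the order: the derivative is
  existentially quantified, so that closure under products and reciprocals follows by exhibiting
  its formula.\<close>

primrec times_differentiable :: "nat \<Rightarrow> (real \<Rightarrow> real) \<Rightarrow> bool" where
  "times_differentiable 0 f \<longleftrightarrow> True"
| "times_differentiable (Suc k) f \<longleftrightarrow>
     (\<exists>f'. (\<forall>x. (f has_real_derivative f' x) (at x)) \<and> times_differentiable k f')"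

lemma times_differentiable_SucD:
  "times_differentiable (Suc k) f \<Longrightarrow> times_differentiable k f"
proof (induction k arbitrary: f)
  case (Suc k)
  from Suc.prems obtain f' where
    "\<forall>x. (f has_real_derivative f' x) (at x)" "times_differentiable (Suc k) f'"
    by (auto simp del: times_differentiable.simps(2) simp: times_differentiable.simps(2)[of "Suc k"])
  with Suc.IH[of f'] show ?case by auto
qed simp

lemma times_differentiable_const: "times_differentiable k (\<lambda>x. c)"
  by (induction k arbitrary: c) (auto intro!: exI[of _ "\<lambda>x. 0"] derivative_eq_intros)

lemma times_differentiable_add:
  "times_differentiable k f \<Longrightarrow> times_differentiable k g \<Longrightarrow> times_differentiable k (\<lambda>x. f x + g x)"
proof (induction k arbitrary: f g)
  case (Suc k)
  from Suc.prems obtain f' g' where d: "\<And>x. (f has_real_derivative f' x) (at x)"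
    "\<And>x. (g has_real_derivative g' x) (at x)" "times_differentiable k f'" "times_differentiable k g'"
    by auto
  show ?case
    using d(1,2) Suc.IH[OF d(3,4)]
    by (auto intro!: exI[of _ "\<lambda>x. f' x + g' x"] derivative_intros)
qed simp

lemma times_differentiable_mult:
  "times_differentiable k f \<Longrightarrow> times_differentiable k g \<Longrightarrow> times_differentiable k (\<lambda>x. f x * g x)"
proof (induction k arbitrary: f g)
  case (Suc k)
  from Suc.prems obtain f' g' where d: "\<And>x. (f has_real_derivative f' x) (at x)"
    "\<And>x. (g has_real_derivative g' x) (at x)" "times_differentiable k f'" "times_differentiable k g'"
    by auto
  have fg: "times_differentiable k f" "times_differentiable k g"
    using Suc.prems by (blast intro: times_differentiable_SucD)+
  have "times_differentiable k (\<lambda>x. f x * g' x + f' x * g x)"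
    by (intro times_differentiable_add Suc.IH d fg)
  moreover have "\<And>x. ((\<lambda>x. f x * g x) has_real_derivative f x * g' x + f' x * g x) (at x)"
    by (rule DERIV_mult'[OF d(1,2)])
  ultimately show ?case by (auto intro!: exI[of _ "\<lambda>x. f x * g' x + f' x * g x"])
qed simp

lemma times_differentiable_inverse:
  assumes "\<And>x. f x \<noteq> 0"
  shows "times_differentiable k f \<Longrightarrow> times_differentiable k (\<lambda>x. inverse (f x))"
proof (induction k)
  case (Suc k)
  from Suc.prems obtain f' where d: "\<And>x. (f has_real_derivative f' x) (at x)"
    "times_differentiable k f'"
    by auto
  have "times_differentiable k (\<lambda>x. inverse (f x))"
    using Suc by (blast intro: times_differentiable_SucD)
  hence "times_differentiable k (\<lambda>x. (-1) * (inverse (f x) * f' x * inverse (f x)))"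
    by (intro times_differentiable_mult times_differentiable_const d)
  moreover have "((\<lambda>x. inverse (f x)) has_real_derivative (-1) * (inverse (f x) * f' x * inverse (f x))) (at x)" for x
    using DERIV_inverse'[OF d(1)[of x] assms] by simp
  ultimately show ?case
    by (auto intro!: exI[of _ "\<lambda>x. (-1) * (inverse (f x) * f' x * inverse (f x))"])
qed simp

lemma times_differentiable_affine:
  "times_differentiable k f \<Longrightarrow> times_differentiable k (\<lambda>x. f (c * x + d))"
proof (induction k arbitrary: f)
  case (Suc k)
  from Suc.prems obtain f' where d: "\<And>x. (f has_real_derivative f' x) (at x)"
    "times_differentiable k f'"
    by auto
  have "times_differentiable k (\<lambda>x. f' (c * x + d) * c)"
    by (intro times_differentiable_mult times_differentiable_const Suc.IH d)
  moreover have "((\<lambda>x. f (c * x + d)) has_real_derivative f' (c * x + d) * c) (at x)" for x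
    by (rule DERIV_chain2[OF d(1)]) (auto intro!: derivative_eq_intros)
  ultimately show ?case
    by (auto intro!: exI[of _ "\<lambda>x. f' (c * x + d) * c"])
qed simp

lemma smooth_if_times_differentiable:
  fixes f :: "real \<Rightarrow> real"
  assumes "\<And>k. times_differentiable k f"
  shows "smooth f"
proof -
  have "times_differentiable k (partials bs f)" if "set bs \<subseteq> Basis" for bs k
    using that
  proof (induction bs arbitrary: k)
    case (Cons b bs)
    have b: "b = 1" and "times_differentiable (Suc k) (partials bs f)"
      using Cons by (auto simp del: times_differentiable.simps)
    then obtain f' where f': "\<And>x. (partials bs f has_real_derivative f' x) (at x)"
      "times_differentiable k f'" by auto
    have "partials (b # bs) f = f'"
      using frechet_derivative_at[OF f'(1)[unfolded has_field_derivative_def]]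
      by (auto simp: fun_eq_iff b) (metis mult.right_neutral)
    with f' show ?case by simp
  qed (use assms in simp)
  from this[of _ "Suc 0"] show ?thesis
    unfolding smooth_def real_differentiable_def times_differentiable.simps by blast
qed

text \<open>The functions \<open>x\<^sup>-\<^sup>n exp(-1/x)\<close>, extended by zero to \<open>x \<le> 0\<close>. All exponents are needed at once, since
  differentiation raises \<open>n\<close>; the family is closed under differentiation up to linear
  combinations.\<close>

definition flat_exp :: "nat \<Rightarrow> real \<Rightarrow> real" where
  "flat_exp n x = (if x > 0 then (1 / x) ^ n * exp (- (1 / x)) else 0)"

lemma flat_exp_tendsto_0: "(flat_exp n \<longlongrightarrow> 0) (at 0)"
proof -
  have "((\<lambda>x. (1 / x) ^ n / exp (1 / x)) \<longlongrightarrow> (0::real)) (at_right 0)"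
    using filterlim_compose[OF tendsto_power_div_exp_0[of n] filterlim_inverse_at_top_right]
    by (simp add: inverse_eq_divide)
  hence "(flat_exp n \<longlongrightarrow> 0) (at_right 0)"
    by (rule Lim_transform_eventually)
      (auto simp: flat_exp_def eventually_at_filter exp_minus field_simps)
  moreover have "(flat_exp n \<longlongrightarrow> 0) (at_left 0)"
    by (rule Lim_transform_eventually[OF tendsto_const])
      (auto simp: flat_exp_def eventually_at_filter)
  ultimately show ?thesis by (simp add: filterlim_at_split)
qed

lemma DERIV_flat_exp:
  "(flat_exp n has_real_derivative flat_exp (n + 2) x - real n * flat_exp (n + 1) x) (at x)"
proof (cases x "0::real" rule: linorder_cases)
  case less
  have "((\<lambda>x. 0) has_real_derivative 0) (at x)" by simp
  thus ?thesis
    using less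
    by (subst DERIV_cong_ev[OF refl _ refl, of _ "\<lambda>x. 0"])
       (auto simp: flat_exp_def intro!: eventually_mono[OF eventually_nhds_in_open[of "{..<0}"]])
next
  case equal
  have "((\<lambda>h. (flat_exp n (0 + h) - flat_exp n 0) / h) \<longlongrightarrow> 0) (at 0)"
    by (rule Lim_transform_eventually[OF flat_exp_tendsto_0[of "n + 1"]])
       (auto simp: flat_exp_def eventually_at_filter)
  thus ?thesis unfolding equal DERIV_def by (simp add: flat_exp_def)
next
  case greater
  have inv: "((\<lambda>x. 1 / x) has_real_derivative - ((1 / x) * (1 / x))) (at x)"
    using greater by (auto intro!: derivative_eq_intros)
  have "((\<lambda>x. (1 / x) ^ n) has_real_derivative - (real n * (1 / x) ^ (n + 1))) (at x)"
    using DERIV_power[OF inv, of n] by (cases n) (simp_all add: algebra_simps)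
  hence "((\<lambda>x. (1 / x) ^ n * exp (- (1 / x))) has_real_derivative
      (1 / x) ^ n * (exp (- (1 / x)) * (1 / x * (1 / x)))
      + - (real n * (1 / x) ^ (n + 1)) * exp (- (1 / x))) (at x)"
    using DERIV_mult'[OF _ DERIV_fun_exp[OF DERIV_minus[OF inv]],
        of "\<lambda>x. (1 / x) ^ n" "- (real n * (1 / x) ^ (n + 1))"] by simp
  hence "((\<lambda>x. (1 / x) ^ n * exp (- (1 / x))) has_real_derivative
      flat_exp (n + 2) x - real n * flat_exp (n + 1) x) (at x)"
    using greater by (simp add: flat_exp_def algebra_simps)
  thus ?thesis
    using greater
    by (subst DERIV_cong_ev[OF refl _ refl, of _ "\<lambda>x. (1 / x) ^ n * exp (- (1 / x))"])
       (auto simp: flat_exp_def intro!: eventually_mono[OF eventually_nhds_in_open[of "{0<..}"]])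
qed

lemma times_differentiable_flat_exp: "times_differentiable k (flat_exp n)"
proof (induction k arbitrary: n)
  case (Suc k)
  have "times_differentiable k (\<lambda>x. flat_exp (n + 2) x + (- real n) * flat_exp (n + 1) x)"
    by (intro times_differentiable_add times_differentiable_mult times_differentiable_const Suc.IH)
  with DERIV_flat_exp[of n] show ?case
    by (auto intro!: exI[of _ "\<lambda>x. flat_exp (n + 2) x + (- real n) * flat_exp (n + 1) x"])
qed simp

text \<open>With the flat function \<open>h = flat_exp 0\<close>, the quotient \<open>h(x) / (h(x) + h(1 - x))\<close> is such a step;
  the denominator is positive because one of \<open>x\<close> and \<open>1 - x\<close> is.\<close>

lemma smooth_step_exists:
  obtains g :: "real \<Rightarrow> real" where "\<And>k. times_differentiable k g"
    "\<And>x. x \<le> 0 \<Longrightarrow> g x = 0" "\<And>x. x \<ge> 1 \<Longrightarrow> g x = 1" "\<And>x. \<bar>g x\<bar> \<le> 1"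
proof
  define h where "h = flat_exp 0"
  define D where "D = (\<lambda>x. h x + h ((-1) * x + 1))"
  have h: "h x \<ge> 0" "x > 0 \<Longrightarrow> h x > 0" "x \<le> 0 \<Longrightarrow> h x = 0" for x
    by (auto simp: h_def flat_exp_def)
  have D: "D x > 0" for x
    using h(1)[of x] h(2)[of x] h(1)[of "1 - x"] h(2)[of "1 - x"]
    by (cases "x > 0") (auto simp: D_def)
  let ?g = "\<lambda>x. h x * inverse (D x)"
  show "times_differentiable k ?g" for k
    using D unfolding D_def h_def
    by (intro times_differentiable_mult times_differentiable_inverse times_differentiable_add
        times_differentiable_affine times_differentiable_flat_exp) (simp add: less_imp_neq[symmetric])
  show "?g x = 0" if "x \<le> 0" for x using that h by simp
  show "?g x = 1" if "x \<ge> 1" for x using that h(3)[of "1 - x"] h(2)[of x] by (simp add: D_def)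
  have "h x \<le> D x" for x using h(1)[of "1 - x"] by (simp add: D_def)
  thus "\<bar>?g x\<bar> \<le> 1" for x
    using h(1)[of x] D[of x] by (simp add: abs_mult field_simps abs_of_pos)
qed

section \<open>Weak derivatives of continuous functions\<close>

text \<open>A kernel of unit mass on an interval of width \<open>w\<close> and of height at most \<open>C / w\<close> averages \<open>z\<close>; the
  constant \<open>C\<close> does not depend on the width, so such averages converge to point values as \<open>w\<close>
  shrinks.\<close>

lemma norm_integral_kernel_diff_le:
  fixes z :: "real \<Rightarrow> 'b::euclidean_space"
  assumes "w > 0" and k: "continuous_on {l..l + w} k" and z: "continuous_on {l..l + w} z"
    and k_le: "\<And>\<tau>. \<tau> \<in> {l..l + w} \<Longrightarrow> \<bar>k \<tau>\<bar> \<le> C / w" and k_int: "(k has_integral 1) {l..l + w}"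
    and z_near: "\<And>\<tau>. \<tau> \<in> {l..l + w} \<Longrightarrow> norm (z \<tau> - z0) \<le> e"
  shows "norm (integral {l..l + w} (\<lambda>\<tau>. k \<tau> *\<^sub>R z \<tau>) - z0) \<le> C * e"
proof -
  have "((\<lambda>\<tau>. k \<tau> *\<^sub>R z0) has_integral 1 *\<^sub>R z0) {l..l + w}"
    using has_integral_scaleR_left[OF k_int] by simp
  moreover have "((\<lambda>\<tau>. k \<tau> *\<^sub>R z \<tau>) has_integral integral {l..l + w} (\<lambda>\<tau>. k \<tau> *\<^sub>R z \<tau>)) {l..l + w}"
    by (intro integrable_integral integrable_continuous_real continuous_intros k z)
  ultimately have "((\<lambda>\<tau>. k \<tau> *\<^sub>R (z \<tau> - z0)) has_integral
      (integral {l..l + w} (\<lambda>\<tau>. k \<tau> *\<^sub>R z \<tau>) - z0)) {l..l + w}"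
    by (auto simp: scaleR_diff_right dest: has_integral_diff)
  moreover have C: "0 \<le> C / w" using k_le[of l] \<open>w > 0\<close> by (smt (verit) atLeastAtMost_iff)
  moreover have e: "0 \<le> e" using z_near[of l] \<open>w > 0\<close> by (smt (verit) atLeastAtMost_iff norm_ge_zero)
  ultimately have "norm (integral {l..l + w} (\<lambda>\<tau>. k \<tau> *\<^sub>R z \<tau>) - z0) \<le> (C / w * e) * measure lborel {l..l + w}"
    using k_le z_near mult_nonneg_nonneg[OF C e]
    by (intro has_integral_bound_real[where f = "\<lambda>\<tau>. k \<tau> *\<^sub>R (z \<tau> - z0)" and S = "{}"])
      (auto intro!: mult_mono simp del: times_divide_eq_left)
  thus ?thesis using \<open>w > 0\<close> by simp
qed

text \<open>Test the weak derivative with smooth approximations \<open>\<psi> n\<close> of the indicator function of \<open>{s..t}\<close>,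
  which rise from 0 to 1 on \<open>[s, s + w n]\<close> and fall back on \<open>[t - w n, t]\<close>. Their derivatives are
  averaging kernels at \<open>s\<close> and, with opposite sign, at \<open>t\<close>, whence one side tends to
  \<open>z s - z t\<close>; the other side tends to \<open>- \<integral>\<^bsub>s\<^esub>\<^bsup>t\<^esup> f\<close> by dominated convergence.\<close>

lemma weak_derivative_increment_interior:
  fixes z f :: "real \<Rightarrow> 'b::euclidean_space"
  assumes weak: "has_weak_derivative {0<..<T} z f" and z: "continuous_on {0..T} z"
    and f: "set_integrable lebesgue {0..T} f" and st: "0 < s" "s < t" "t < T"
  shows "z t - z s = integral {s..t} f"
proof -
  obtain g :: "real \<Rightarrow> real" where g_smooth: "\<And>k. times_differentiable k g"
    and g0: "\<And>x. x \<le> 0 \<Longrightarrow> g x = 0" and g1: "\<And>x. x \<ge> 1 \<Longrightarrow> g x = 1" and g_le: "\<And>x. \<bar>g x\<bar> \<le> 1"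
    using smooth_step_exists by metis
  from g_smooth[of "Suc (Suc 0)"] obtain g' g'' where
    g': "\<And>x. (g has_real_derivative g' x) (at x)" and g'': "\<And>x. (g' has_real_derivative g'' x) (at x)"
    by auto
  have cont_g': "continuous_on S g'" for S
    using g'' by (intro continuous_at_imp_continuous_on) (auto intro: DERIV_isCont)
  have "bounded (g' ` {0..1})"
    by (intro compact_imp_bounded compact_continuous_image cont_g' compact_Icc)
  then obtain C where C: "\<And>x. x \<in> {0..1} \<Longrightarrow> \<bar>g' x\<bar> \<le> C"
    unfolding bounded_iff real_norm_def by blast
  have g'_zero: "g' x = 0" if "x < 0 \<or> x > 1" for x
  proof -
    define U :: "real set" where "U = (if x < 0 then {..<0} else {1<..})"
    define c :: real where "c = (if x < 0 then 0 else 1)"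
    have "eventually (\<lambda>y. y \<in> U) (nhds x)"
      using that by (intro eventually_nhds_in_open) (auto simp: U_def)
    hence "eventually (\<lambda>y. g y = c) (nhds x)"
      by (rule eventually_mono) (auto simp: U_def c_def g0 g1 split: if_splits)
    hence "((\<lambda>_. c) has_real_derivative g' x) (at x)"
      using g'[of x] DERIV_cong_ev[of x x g "\<lambda>_. c" "g' x" "g' x"] by simp
    thus ?thesis using DERIV_unique DERIV_const by blast
  qed
  \<comment> \<open>At most half of the length of the interval, so that the two ramps do not overlap.\<close>
  define w where "w n = (t - s) / real (n + 2)" for n
  have w: "w n > 0" "2 * w n \<le> t - s" for n
    using st mult_left_mono[of 2 "real (n + 2)" "t - s"] by (simp_all add: w_def field_simps)
  have w_lim: "w \<longlonglongrightarrow> 0"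
    unfolding w_def using LIMSEQ_ignore_initial_segment[OF lim_const_over_n[of "t - s"], of 2] by simp
  define up where "up n \<tau> = g' ((\<tau> - s) / w n) / w n" for n \<tau>
  define down where "down n \<tau> = g' ((t - \<tau>) / w n) / w n" for n \<tau>
  define \<psi> where "\<psi> n \<tau> = g ((\<tau> - s) / w n) + g ((t - \<tau>) / w n) - 1" for n \<tau>
  have D_up: "((\<lambda>\<tau>. g ((\<tau> - s) / w n)) has_real_derivative up n \<tau>) (at \<tau>)" for n \<tau>
  proof -
    have "((\<lambda>\<tau>. (\<tau> - s) / w n) has_real_derivative 1 / w n) (at \<tau>)"
      using w(1)[of n] by (auto intro!: derivative_eq_intros)
    from DERIV_chain2[OF g' this] show ?thesis by (simp add: up_def)
  qed
  have D_down: "((\<lambda>\<tau>. g ((t - \<tau>) / w n)) has_real_derivative - down n \<tau>) (at \<tau>)" for n \<tau>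
  proof -
    have "((\<lambda>\<tau>. (t - \<tau>) / w n) has_real_derivative - 1 / w n) (at \<tau>)"
      using w(1)[of n] by (auto intro!: derivative_eq_intros)
    from DERIV_chain2[OF g' this] show ?thesis by (simp add: down_def)
  qed
  have D_\<psi>: "(\<psi> n has_real_derivative up n \<tau> - down n \<tau>) (at \<tau>)" for n \<tau>
    unfolding \<psi>_def using DERIV_diff[OF DERIV_add[OF D_up[of n \<tau>] D_down[of n \<tau>]] DERIV_const[of 1]]
    by simp
  hence deriv_\<psi>: "deriv (\<psi> n) \<tau> = up n \<tau> - down n \<tau>" for n \<tau>
    by (rule DERIV_imp_deriv)
  have \<psi>_0: "\<psi> n \<tau> = 0" if "\<tau> \<notin> {s<..<t}" for n \<tau>
  proof (cases "\<tau> \<le> s")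
    case True
    hence "(t - \<tau>) / w n \<ge> 1" using w[of n] by (simp add: field_simps)
    moreover have "(\<tau> - s) / w n \<le> 0" using True w(1)[of n] by (simp add: field_simps)
    ultimately show ?thesis by (simp add: \<psi>_def g0 g1)
  next
    case False
    with that have t: "\<tau> \<ge> t" by auto
    hence "(\<tau> - s) / w n \<ge> 1" using w[of n] by (simp add: field_simps)
    moreover have "(t - \<tau>) / w n \<le> 0" using t w(1)[of n] by (simp add: field_simps)
    ultimately show ?thesis by (simp add: \<psi>_def g0 g1)
  qed
  have "smooth (\<psi> n)" for n
  proof (rule smooth_if_times_differentiable)
    fix k
    have "times_differentiable k (\<lambda>\<tau>. g ((1 / w n) * \<tau> + - s / w n)
        + g ((- 1 / w n) * \<tau> + t / w n) + - 1)"
      by (intro times_differentiable_add times_differentiable_const times_differentiable_affine g_smooth)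
    also have "(\<lambda>\<tau>. g ((1 / w n) * \<tau> + - s / w n) + g ((- 1 / w n) * \<tau> + t / w n) + - 1) = \<psi> n"
      by (auto simp: \<psi>_def fun_eq_iff diff_divide_distrib)
    finally show "times_differentiable k (\<psi> n)" .
  qed
  hence test: "test_function {0<..<T} (\<psi> n)" for n
    unfolding test_function_def using \<psi>_0 st by (auto intro!: exI[of _ "{s..t}"])
  have weak_n: "(LINT \<tau>:{0<..<T}|lebesgue. \<psi> n \<tau> *\<^sub>R f \<tau>)
      = - (LINT \<tau>:{0<..<T}|lebesgue. deriv (\<psi> n) \<tau> *\<^sub>R z \<tau>)" for n
    using weak test[of n] unfolding has_weak_derivative_def by simp
  have sub: "{s..s + w n} \<subseteq> {0<..<T}" "{t - w n..t} \<subseteq> {0<..<T}" for n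
    using w[of n] st by auto
  have z_on: "continuous_on S z" if "S \<subseteq> {0<..<T}" for S
    using that by (intro continuous_on_subset[OF z]) (auto simp: subset_iff)
  have cont_g'_comp: "continuous_on S (\<lambda>\<tau>. g' (h \<tau>))" if "continuous_on S h" for h :: "real \<Rightarrow> real" and S
    by (rule continuous_on_compose2[OF cont_g'[of UNIV] that]) simp
  have up_cont: "continuous_on S (up n)" and down_cont: "continuous_on S (down n)" for S n
    unfolding up_def down_def
    using w(1)[of n] by (auto intro!: continuous_intros cont_g'_comp simp: less_imp_neq[symmetric])
  have localize: "set_integrable lebesgue {0<..<T} h \<and>
      (LINT \<tau>:{0<..<T}|lebesgue. h \<tau>) = integral {l..r} h"
    if h: "continuous_on {l..r} h" and lr: "{l..r} \<subseteq> {0<..<T}"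
      and out: "\<And>\<tau>. \<tau> \<notin> {l..r} \<Longrightarrow> h \<tau> = 0" for h :: "real \<Rightarrow> 'b" and l r
  proof -
    have *: "(\<lambda>\<tau>. indicator {0<..<T} \<tau> *\<^sub>R h \<tau>) = (\<lambda>\<tau>. indicator {l..r} \<tau> *\<^sub>R h \<tau>)"
      using lr out by (auto simp: fun_eq_iff indicator_def subset_iff)
    have "set_integrable lebesgue {l..r} h"
      using absolutely_integrable_continuous_real[OF h] .
    thus ?thesis
      using set_lebesgue_integral_eq_integral(2)[of "{l..r}" h]
      unfolding set_integrable_def set_lebesgue_integral_def * by simp
  qed
  have up_z: "set_integrable lebesgue {0<..<T} (\<lambda>\<tau>. up n \<tau> *\<^sub>R z \<tau>) \<and>
      (LINT \<tau>:{0<..<T}|lebesgue. up n \<tau> *\<^sub>R z \<tau>) = integral {s..s + w n} (\<lambda>\<tau>. up n \<tau> *\<^sub>R z \<tau>)" for n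
  proof (rule localize[OF _ sub(1)])
    show "up n \<tau> *\<^sub>R z \<tau> = 0" if "\<tau> \<notin> {s..s + w n}" for \<tau>
      using that w(1)[of n] g'_zero[of "(\<tau> - s) / w n"] by (auto simp: up_def field_simps)
  qed (rule continuous_on_scaleR[OF up_cont z_on[OF sub(1)]])
  have down_z: "set_integrable lebesgue {0<..<T} (\<lambda>\<tau>. down n \<tau> *\<^sub>R z \<tau>) \<and>
      (LINT \<tau>:{0<..<T}|lebesgue. down n \<tau> *\<^sub>R z \<tau>) = integral {t - w n..t} (\<lambda>\<tau>. down n \<tau> *\<^sub>R z \<tau>)" for n
  proof (rule localize[OF _ sub(2)])
    show "down n \<tau> *\<^sub>R z \<tau> = 0" if "\<tau> \<notin> {t - w n..t}" for \<tau>
      using that w(1)[of n] g'_zero[of "(t - \<tau>) / w n"] by (auto simp: down_def field_simps)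
  qed (rule continuous_on_scaleR[OF down_cont z_on[OF sub(2)]])
  have lhs: "(LINT \<tau>:{0<..<T}|lebesgue. deriv (\<psi> n) \<tau> *\<^sub>R z \<tau>)
      = integral {s..s + w n} (\<lambda>\<tau>. up n \<tau> *\<^sub>R z \<tau>) - integral {t - w n..t} (\<lambda>\<tau>. down n \<tau> *\<^sub>R z \<tau>)" for n
    using up_z[of n] down_z[of n] by (simp add: deriv_\<psi> scaleR_diff_left)
  have up_int: "(up n has_integral 1) {s..s + w n}" for n
  proof -
    have "(up n has_integral g ((s + w n - s) / w n) - g ((s - s) / w n)) {s..s + w n}"
      using w(1)[of n] D_up[of n]
      by (intro fundamental_theorem_of_calculus)
        (auto simp: has_real_derivative_iff_has_vector_derivative intro: has_vector_derivative_at_within)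
    thus ?thesis using w(1)[of n] g0[of 0] g1[of 1] by simp
  qed
  have down_int: "(down n has_integral 1) {t - w n..t}" for n
  proof -
    have "((\<lambda>\<tau>. - down n \<tau>) has_integral g ((t - t) / w n) - g ((t - (t - w n)) / w n)) {t - w n..t}"
      using w(1)[of n] D_down[of n]
      by (intro fundamental_theorem_of_calculus)
        (auto simp: has_real_derivative_iff_has_vector_derivative intro: has_vector_derivative_at_within)
    hence "((\<lambda>\<tau>. - down n \<tau>) has_integral - 1) {t - w n..t}"
      using w(1)[of n] g0[of 0] g1[of 1] by simp
    from has_integral_neg[OF this] show ?thesis by simp
  qed
  have concentrate: "(\<lambda>n. integral {l n..l n + w n} (\<lambda>\<tau>. k n \<tau> *\<^sub>R z \<tau>)) \<longlonglongrightarrow> z c"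
    if c: "0 < c" "c < T" and l: "\<And>n. l n \<le> c" "\<And>n. c \<le> l n + w n"
      and sub: "\<And>n. {l n..l n + w n} \<subseteq> {0<..<T}"
      and k: "\<And>n. continuous_on {l n..l n + w n} (k n)"
      and k_le: "\<And>n \<tau>. \<tau> \<in> {l n..l n + w n} \<Longrightarrow> \<bar>k n \<tau>\<bar> \<le> C / w n"
      and k_int: "\<And>n. (k n has_integral 1) {l n..l n + w n}" for l k c
  proof (rule LIMSEQ_I)
    fix e :: real assume e: "e > 0"
    have "C \<ge> 0" using C[of 0] by simp
    \<comment> \<open>The summand 1 covers \<open>C = 0\<close> and makes the final inequality strict.\<close>
    define e' where "e' = e / (C + 1)"
    have e': "e' > 0" "C * e' < e" using e \<open>C \<ge> 0\<close> by (auto simp: e'_def field_simps)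
    have "isCont z c" using continuous_on_interior[OF z, of c] c by simp
    then obtain d where d: "d > 0" "\<And>\<tau>. \<bar>\<tau> - c\<bar> < d \<Longrightarrow> norm (z \<tau> - z c) < e'"
      using e'(1) by (auto simp: continuous_at_eps_delta dist_norm)
    from LIMSEQ_D[OF w_lim d(1)] obtain N where N: "\<And>n. n \<ge> N \<Longrightarrow> w n < d"
      using w(1) by (auto simp: abs_of_pos)
    show "\<exists>N. \<forall>n\<ge>N. norm (integral {l n..l n + w n} (\<lambda>\<tau>. k n \<tau> *\<^sub>R z \<tau>) - z c) < e"
    proof (intro exI[of _ N] allI impI)
      fix n assume "n \<ge> N"
      have "norm (integral {l n..l n + w n} (\<lambda>\<tau>. k n \<tau> *\<^sub>R z \<tau>) - z c) \<le> C * e'"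
      proof (rule norm_integral_kernel_diff_le[OF w(1) k z_on[OF sub] k_le k_int])
        fix \<tau> assume "\<tau> \<in> {l n..l n + w n}"
        hence "\<bar>\<tau> - c\<bar> < d" using N[OF \<open>n \<ge> N\<close>] l[of n] by auto
        thus "norm (z \<tau> - z c) \<le> e'" using d(2) by (simp add: less_imp_le)
      qed auto
      thus "norm (integral {l n..l n + w n} (\<lambda>\<tau>. k n \<tau> *\<^sub>R z \<tau>) - z c) < e" using e'(2) by simp
    qed
  qed
  have up_lim: "(\<lambda>n. integral {s..s + w n} (\<lambda>\<tau>. up n \<tau> *\<^sub>R z \<tau>)) \<longlonglongrightarrow> z s"
  proof (rule concentrate)
    show "\<bar>up n \<tau>\<bar> \<le> C / w n" if "\<tau> \<in> {s..s + w n}" for n \<tau>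
      using that w(1)[of n] C[of "(\<tau> - s) / w n"] by (simp add: up_def divide_right_mono)
    show "0 < s" "s < T" using st by auto
    show "s \<le> s + w n" for n using w(1)[of n] by simp
  qed (rule order_refl sub(1) up_cont up_int)+
  have down_lim: "(\<lambda>n. integral {t - w n..t} (\<lambda>\<tau>. down n \<tau> *\<^sub>R z \<tau>)) \<longlonglongrightarrow> z t"
  proof -
    have "(\<lambda>n. integral {t - w n..t - w n + w n} (\<lambda>\<tau>. down n \<tau> *\<^sub>R z \<tau>)) \<longlonglongrightarrow> z t"
    proof (rule concentrate)
      show "\<bar>down n \<tau>\<bar> \<le> C / w n" if "\<tau> \<in> {t - w n..t - w n + w n}" for n \<tau>
        using that w(1)[of n] C[of "(t - \<tau>) / w n"]
        by (simp add: down_def divide_right_mono field_simps)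
      show "{t - w n..t - w n + w n} \<subseteq> {0<..<T}" for n using sub(2)[of n] by simp
      show "0 < t" "t < T" using st by auto
      show "t - w n \<le> t" "t \<le> t - w n + w n" for n using w(1)[of n] by auto
      show "(down n has_integral 1) {t - w n..t - w n + w n}" for n using down_int[of n] by simp
    qed (rule down_cont)
    thus ?thesis by simp
  qed
  have rhs_lim: "(\<lambda>n. LINT \<tau>:{0<..<T}|lebesgue. \<psi> n \<tau> *\<^sub>R f \<tau>) \<longlonglongrightarrow> integral {s..t} f"
  proof -
    have "(\<lambda>n. LINT \<tau>|lebesgue. \<psi> n \<tau> *\<^sub>R (indicator {0..T} \<tau> *\<^sub>R f \<tau>))
        \<longlonglongrightarrow> (LINT \<tau>|lebesgue. indicator {s<..<t} \<tau> *\<^sub>R f \<tau>)"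
    proof (rule integral_dominated_convergence)
      have f_int: "integrable lebesgue (\<lambda>\<tau>. indicator {0..T} \<tau> *\<^sub>R f \<tau>)"
        using f by (simp add: set_integrable_def)
      show "integrable lebesgue (\<lambda>\<tau>. 3 * norm (indicator {0..T} \<tau> *\<^sub>R f \<tau>))"
        using f_int by (intro integrable_mult_right integrable_norm)
      have "continuous_on UNIV (\<psi> n)" for n
        by (intro continuous_at_imp_continuous_on ballI DERIV_isCont[OF D_\<psi>])
      hence [measurable]: "\<psi> n \<in> borel_measurable lebesgue" for n
        by (intro measurable_completion) (simp add: borel_measurable_continuous_onI)
      show "(\<lambda>\<tau>. \<psi> n \<tau> *\<^sub>R (indicator {0..T} \<tau> *\<^sub>R f \<tau>)) \<in> borel_measurable lebesgue" for n
        by (rule borel_measurable_scaleR[OF _ borel_measurable_integrable[OF f_int]]) measurable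
      have "set_integrable lebesgue {s<..<t} f"
        using st by (intro set_integrable_subset[OF f]) auto
      thus "(\<lambda>\<tau>. indicator {s<..<t} \<tau> *\<^sub>R f \<tau>) \<in> borel_measurable lebesgue"
        unfolding set_integrable_def by (rule borel_measurable_integrable)
      have \<psi>_le: "\<bar>\<psi> n \<tau>\<bar> \<le> 3" for n \<tau>
        using g_le[of "(\<tau> - s) / w n"] g_le[of "(t - \<tau>) / w n"] by (simp add: \<psi>_def)
      show "AE \<tau> in lebesgue. norm (\<psi> n \<tau> *\<^sub>R (indicator {0..T} \<tau> *\<^sub>R f \<tau>))
          \<le> 3 * norm (indicator {0..T} \<tau> *\<^sub>R f \<tau>)" for n
        by (intro AE_I2) (simp only: norm_scaleR[of "\<psi> n _"] mult_right_mono[OF \<psi>_le norm_ge_zero])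
      show "AE \<tau> in lebesgue. (\<lambda>n. \<psi> n \<tau> *\<^sub>R (indicator {0..T} \<tau> *\<^sub>R f \<tau>))
          \<longlonglongrightarrow> indicator {s<..<t} \<tau> *\<^sub>R f \<tau>"
      proof (intro AE_I2)
        fix \<tau>
        show "(\<lambda>n. \<psi> n \<tau> *\<^sub>R (indicator {0..T} \<tau> *\<^sub>R f \<tau>)) \<longlonglongrightarrow> indicator {s<..<t} \<tau> *\<^sub>R f \<tau>"
        proof (cases "\<tau> \<in> {s<..<t}")
          case True
          have "eventually (\<lambda>n. w n < min (\<tau> - s) (t - \<tau>)) sequentially"
            using True by (intro order_tendstoD(2)[OF w_lim]) auto
          hence "eventually (\<lambda>n. f \<tau> = \<psi> n \<tau> *\<^sub>R (indicator {0..T} \<tau> *\<^sub>R f \<tau>)) sequentially"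
          proof eventually_elim
            case (elim n)
            hence "(\<tau> - s) / w n \<ge> 1" "(t - \<tau>) / w n \<ge> 1"
              using w(1)[of n] by (auto simp: field_simps)
            thus ?case using True st by (simp add: \<psi>_def g1)
          qed
          thus ?thesis using True by (auto intro: Lim_transform_eventually[OF tendsto_const])
        qed (simp add: \<psi>_0)
      qed
    qed
    moreover have "(\<lambda>\<tau>. \<psi> n \<tau> *\<^sub>R (indicator {0..T} \<tau> *\<^sub>R f \<tau>))
        = (\<lambda>\<tau>. indicator {0<..<T} \<tau> *\<^sub>R (\<psi> n \<tau> *\<^sub>R f \<tau>))" for n
    proof
      fix \<tau>
      show "\<psi> n \<tau> *\<^sub>R (indicator {0..T} \<tau> *\<^sub>R f \<tau>) = indicator {0<..<T} \<tau> *\<^sub>R (\<psi> n \<tau> *\<^sub>R f \<tau>)"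
        using \<psi>_0[of \<tau> n] st by (cases "\<tau> \<in> {s<..<t}") (auto simp: indicator_def)
    qed
    moreover have "(LINT \<tau>|lebesgue. indicator {s<..<t} \<tau> *\<^sub>R f \<tau>) = integral {s..t} f"
    proof -
      have "{s<..<t} \<subseteq> {0..T}" using st by auto
      hence "set_integrable lebesgue {s<..<t} f" by (intro set_integrable_subset[OF f]) auto
      thus ?thesis
        using set_lebesgue_integral_eq_integral(2)[of "{s<..<t}" f]
        by (simp add: set_lebesgue_integral_def integral_open_interval_real)
    qed
    ultimately show ?thesis by (simp only: set_lebesgue_integral_def)
  qed
  have "- (z s - z t) = integral {s..t} f"
    using LIMSEQ_unique[OF tendsto_minus[OF tendsto_diff[OF up_lim down_lim]] rhs_lim[unfolded weak_n lhs]] .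
  thus ?thesis by simp
qed

text \<open>Test functions see only the open interval; continuity of \<open>z\<close> and of the integral extends the
  identity to the end points.\<close>

lemma weak_derivative_increment:
  fixes z f :: "real \<Rightarrow> 'b::euclidean_space"
  assumes weak: "has_weak_derivative {0<..<T} z f" and z: "continuous_on {0..T} z"
    and f: "set_integrable lebesgue {0..T} f" and st: "0 \<le> s" "s \<le> t" "t \<le> T"
  shows "z t - z s = integral {s..t} f"
proof (cases "T > 0")
  case True
  have f_int: "f integrable_on {0..T}" using set_lebesgue_integral_eq_integral(1)[OF f] .
  have split: "integral {0..t} f - integral {0..s} f = integral {s..t} f"
    if "0 \<le> s" "s \<le> t" "t \<le> T" for s t
  proof -
    have "integral {0..s} f + integral {s..t} f = integral {0..t} f"
      using that
      by (intro Henstock_Kurzweil_Integration.integral_combine integrable_subinterval_real[OF f_int]) auto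
    thus ?thesis by (metis add_diff_cancel_left')
  qed
  define J where "J t = z t - integral {0..t} f" for t
  have J_diff: "J t - J s = z t - z s - integral {s..t} f" if "0 \<le> s" "s \<le> t" "t \<le> T" for s t
    unfolding split[OF that, symmetric] J_def by simp
  have J_eq: "J t = J s" if "0 < s" "s < t" "t < T" for s t
    using weak_derivative_increment_interior[OF weak z f that] J_diff[of s t] that by simp
  have J_mid: "J t = J (T / 2)" if "t \<in> {0<..<T}" for t
  proof (cases t "T / 2" rule: linorder_cases)
    case less
    thus ?thesis using J_eq[of t "T / 2"] that by simp
  next
    case greater
    thus ?thesis using J_eq[of "T / 2" t] that by simp
  next
    case equal
    thus ?thesis by (rule arg_cong)
  qed
  have "continuous_on {0..T} J"
    unfolding J_def by (intro continuous_intros z indefinite_integral_continuous_1 f_int)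
  hence "continuous_on (closure {0<..<T}) J" using True by simp
  from continuous_constant_on_closure[OF this J_mid]
  have "J t = J (T / 2)" if "t \<in> {0..T}" for t
    using True that by (simp only: closure_greaterThanLessThan)
  from this[of s] this[of t] have "J t - J s = 0" using st by simp
  thus ?thesis using J_diff[OF st] by simp
next
  case False
  hence "s = t" using st by simp
  thus ?thesis by simp
qed

section \<open>From increments to integrals\<close>

text \<open>The step size \<open>\<delta>\<close> is uniform, so finitely many steps lead from \<open>a\<close> to \<open>b\<close>.\<close>

lemma antimono_if_locally_antimono:
  fixes F :: "real \<Rightarrow> real"
  assumes "\<delta> > 0"
    and loc: "\<And>s t. a \<le> s \<Longrightarrow> s \<le> t \<Longrightarrow> t \<le> b \<Longrightarrow> t - s < \<delta> \<Longrightarrow> F t \<le> F s"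
    and "a \<le> b"
  shows "F b \<le> F a"
proof -
  obtain n :: nat where n: "(b - a) / \<delta> < real n" using reals_Archimedean2 by blast
  have "F t \<le> F s" if "a \<le> s" "s \<le> t" "t \<le> b" "t - s \<le> real n * (\<delta> / 2)" for n s t
    using that
  proof (induction n arbitrary: t)
    case (Suc n)
    define r where "r = max s (t - \<delta> / 2)"
    have "0 \<le> \<delta> * real n" using assms(1) by simp
    hence "F r \<le> F s"
      using Suc.prems assms(1) by (intro Suc.IH) (auto simp: r_def algebra_simps max_def)
    moreover have "F t \<le> F r" using Suc.prems assms(1) by (intro loc) (auto simp: r_def)
    ultimately show ?case by simp
  qed simp
  from this[of a b "2 * n"] n assms show ?thesis by (simp add: field_simps)
qed

lemma absolutely_integrable_inner_continuous:
  fixes p f :: "real \<Rightarrow> 'a::euclidean_space"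
  assumes p: "continuous_on {a..b} p" and f: "f absolutely_integrable_on {a..b}"
  shows "(\<lambda>\<tau>. p \<tau> \<bullet> f \<tau>) absolutely_integrable_on {a..b}"
proof (rule absolutely_integrable_bounded_measurable_product[where h = "(\<bullet>)", OF _ _ _ _ f])
  show "bilinear ((\<bullet>) :: 'a \<Rightarrow> 'a \<Rightarrow> real)"
    by (simp add: bilinear_conv_bounded_bilinear bounded_bilinear_inner)
  show "p \<in> borel_measurable (lebesgue_on {a..b})"
    by (rule continuous_imp_measurable_on_sets_lebesgue[OF p]) simp
  show "bounded (p ` {a..b})"
    by (rule compact_imp_bounded[OF compact_continuous_image[OF p compact_Icc]])
qed simp

text \<open>A one-sided Riemann--Stieltjes argument. On intervals on which \<open>p\<close> varies by less than \<open>e\<close>, the value \<open>p t\<close> may be replaced by \<open>p \<tau>\<close>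
  under the integral at the price of \<open>e \<cdot> norm (f \<tau>)\<close>. Hence \<open>\<phi>\<close> minus the integral of
  \<open>p \<tau> \<bullet> f \<tau> + e \<cdot> norm (f \<tau>)\<close> decreases on short intervals, thus on all of \<open>{a..b}\<close>; let \<open>e\<close> tend
  to 0.\<close>

lemma increment_le_integral_inner:
  fixes \<phi> :: "real \<Rightarrow> real" and p f :: "real \<Rightarrow> 'a::euclidean_space"
  assumes p: "continuous_on {a..b} p" and f: "f absolutely_integrable_on {a..b}" and "a \<le> b"
    and le: "\<And>s t. a \<le> s \<Longrightarrow> s \<le> t \<Longrightarrow> t \<le> b \<Longrightarrow> \<phi> t - \<phi> s \<le> p t \<bullet> integral {s..t} f"
  shows "\<phi> b - \<phi> a \<le> integral {a..b} (\<lambda>\<tau>. p \<tau> \<bullet> f \<tau>)"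
proof -
  have pf: "(\<lambda>\<tau>. p \<tau> \<bullet> f \<tau>) absolutely_integrable_on {a..b}"
    by (rule absolutely_integrable_inner_continuous[OF p f])
  have nf: "(\<lambda>\<tau>. norm (f \<tau>)) absolutely_integrable_on {a..b}"
    by (rule absolutely_integrable_norm[OF f, unfolded o_def])
  define I where "I = integral {a..b} (\<lambda>\<tau>. norm (f \<tau>))"
  have bound: "\<phi> b - \<phi> a \<le> integral {a..b} (\<lambda>\<tau>. p \<tau> \<bullet> f \<tau>) + e * I" if e: "e > 0" for e
  proof -
    let ?g = "\<lambda>\<tau>. p \<tau> \<bullet> f \<tau> + e * norm (f \<tau>)"
    have "uniformly_continuous_on {a..b} p" by (rule compact_uniformly_continuous[OF p]) simp
    then obtain \<delta> where \<delta>: "\<delta> > 0"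
      "\<And>t \<tau>. t \<in> {a..b} \<Longrightarrow> \<tau> \<in> {a..b} \<Longrightarrow> dist \<tau> t < \<delta> \<Longrightarrow> dist (p \<tau>) (p t) < e"
      using e unfolding uniformly_continuous_on_def by metis
    have g: "?g integrable_on {a..b}"
      using pf nf by (intro integrable_add integrable_on_mult_right)
        (auto simp: absolutely_integrable_on_def)
    have "\<phi> t - integral {a..t} ?g \<le> \<phi> s - integral {a..s} ?g"
      if st: "a \<le> s" "s \<le> t" "t \<le> b" "t - s < \<delta>" for s t
    proof -
      have f_st: "f integrable_on {s..t}" and g_st: "?g integrable_on {s..t}"
        using f g st by (auto intro: integrable_subinterval_real simp: absolutely_integrable_on_def)
      have "p t \<bullet> integral {s..t} f = integral {s..t} (\<lambda>\<tau>. p t \<bullet> f \<tau>)"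
        using integral_linear[OF f_st bounded_linear_inner_right[of "p t"]] by (simp add: o_def)
      also have "\<dots> \<le> integral {s..t} ?g"
      proof (rule integral_le[OF _ g_st])
        show "(\<lambda>\<tau>. p t \<bullet> f \<tau>) integrable_on {s..t}"
          using integrable_linear[OF f_st bounded_linear_inner_right[of "p t"]] by (simp add: o_def)
        fix \<tau> assume \<tau>: "\<tau> \<in> {s..t}"
        have "norm (p t - p \<tau>) < e"
          using \<delta>(2)[of t \<tau>] \<tau> st by (auto simp: dist_norm norm_minus_commute)
        hence "(p t - p \<tau>) \<bullet> f \<tau> \<le> e * norm (f \<tau>)"
          by (meson norm_cauchy_schwarz order_trans mult_right_mono less_imp_le norm_ge_zero)
        thus "p t \<bullet> f \<tau> \<le> ?g \<tau>" by (simp add: inner_diff_left)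
      qed
      finally have "\<phi> t - \<phi> s \<le> integral {s..t} ?g" using le[OF st(1-3)] by simp
      moreover have "integral {a..s} ?g + integral {s..t} ?g = integral {a..t} ?g"
        using st by (intro Henstock_Kurzweil_Integration.integral_combine integrable_subinterval_real[OF g]) auto
      ultimately show ?thesis by simp
    qed
    from antimono_if_locally_antimono[of \<delta> a b "\<lambda>t. \<phi> t - integral {a..t} ?g", OF \<delta>(1) this \<open>a \<le> b\<close>]
    have "\<phi> b - \<phi> a \<le> integral {a..b} ?g" by simp
    also have "\<dots> = integral {a..b} (\<lambda>\<tau>. p \<tau> \<bullet> f \<tau>) + e * I"
      unfolding I_def using pf nf
      by (subst integral_add) (auto simp: absolutely_integrable_on_def intro: integrable_on_mult_right)
    finally show ?thesis .
  qed
  have "I \<ge> 0" unfolding I_def by (rule integral_nonneg) (use nf in \<open>auto simp: absolutely_integrable_on_def\<close>)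
  show "\<phi> b - \<phi> a \<le> integral {a..b} (\<lambda>\<tau>. p \<tau> \<bullet> f \<tau>)"
  proof (rule field_le_epsilon)
    fix e :: real assume "e > 0"
    hence "\<phi> b - \<phi> a \<le> integral {a..b} (\<lambda>\<tau>. p \<tau> \<bullet> f \<tau>) + e / (I + 1) * I"
      using \<open>I \<ge> 0\<close> by (intro bound) simp
    also have "e / (I + 1) * I \<le> e" using \<open>e > 0\<close> \<open>I \<ge> 0\<close> by (simp add: field_simps)
    finally show "\<phi> b - \<phi> a \<le> integral {a..b} (\<lambda>\<tau>. p \<tau> \<bullet> f \<tau>) + e" by simp
  qed
qed

section \<open>Block structure of the semidiscretized system\<close>

definition join :: "real^'a \<Rightarrow> real^'b \<Rightarrow> real^('a::finite + 'b::finite)" where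
  "join x y = (\<chi> k. case k of Inl i \<Rightarrow> x $ i | Inr j \<Rightarrow> y $ j)"

definition lower_part :: "real^('a::finite + 'b::finite) \<Rightarrow> real^'b" where
  "lower_part x = (\<chi> k. x $ Inr k)"

lemma sum_UNIV_Plus:
  "(\<Sum>k\<in>UNIV. f k) = (\<Sum>i\<in>UNIV. f (Inl i)) + (\<Sum>j\<in>UNIV. f (Inr j))"
  for f :: "'a::finite + 'b::finite \<Rightarrow> 'c::comm_monoid_add"
  by (subst UNIV_Plus_UNIV[symmetric], subst sum.Plus) simp_all

lemma inner_join: "x \<bullet> join a b = upper_part x \<bullet> a + lower_part x \<bullet> b"
  by (simp add: inner_vec_def sum_UNIV_Plus join_def upper_part_def lower_part_def)

lemma upper_part_join [simp]: "upper_part (join a b) = a"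
  and lower_part_join [simp]: "lower_part (join a b) = b"
  by (simp_all add: join_def upper_part_def lower_part_def)

lemma bounded_linear_upper_part: "bounded_linear upper_part"
  unfolding linear_conv_bounded_linear[symmetric]
  by (rule linearI) (simp_all add: upper_part_def vec_eq_iff)

lemma bounded_linear_lower_part: "bounded_linear lower_part"
  unfolding linear_conv_bounded_linear[symmetric]
  by (rule linearI) (simp_all add: lower_part_def vec_eq_iff)

lemma continuous_on_join:
  assumes "continuous_on S f" "continuous_on S g"
  shows "continuous_on S (\<lambda>x. join (f x) (g x))"
  unfolding join_def
proof (rule continuous_on_vec_lambda)
  fix k :: "'b + 'c"
  show "continuous_on S (\<lambda>x. case k of Inl i \<Rightarrow> f x $ i | Inr j \<Rightarrow> g x $ j)"
    using assms by (cases k) (auto intro: continuous_intros)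
qed

lemma block_matrix_vector_mult:
  "block_matrix P Q U V *v x
     = join (P *v upper_part x + Q *v lower_part x) (U *v upper_part x + V *v lower_part x)"
proof (rule vec_eq_iff[THEN iffD2], rule allI)
  fix k :: "'a + 'b"
  show "(block_matrix P Q U V *v x) $ k = join (P *v upper_part x + Q *v lower_part x) (U *v upper_part x + V *v lower_part x) $ k"
    by (cases k) (simp_all add: block_matrix_def join_def matrix_vector_mult_def sum_UNIV_Plus
        upper_part_def lower_part_def)
qed

lemma E_FE_mult: "E_FE M X *v x = join (M *v upper_part x) (transpose X *v upper_part x)"
  by (simp add: E_FE_def block_matrix_vector_mult)

lemma uminus_matrix_vector_mult: "(- A) *v x = - (A *v x)" for A :: "real^'n^'m"
  by (simp add: vec_eq_iff matrix_vector_mult_def sum_negf)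

lemma A_FE_mult:
  "A_FE K X R x *v x = join (- (K (upper_part x) *v upper_part x - X *v lower_part x)) (- (R *v lower_part x))"
  by (simp add: A_FE_def block_matrix_vector_mult uminus_matrix_vector_mult)

lemma B_FE_mult: "B_FE *v u = join 0 u"
proof (rule vec_eq_iff[THEN iffD2], rule allI)
  fix k :: "'a + 'b"
  show "(B_FE *v u) $ k = join 0 u $ k"
  proof (cases k)
    case (Inl l)
    thus ?thesis by (simp add: B_FE_def join_def matrix_vector_mult_def)
  next
    case (Inr j)
    hence "(B_FE *v u) $ k = (mat 1 *v u) $ j" by (simp add: B_FE_def matrix_vector_mult_def)
    thus ?thesis using Inr by (simp add: join_def)
  qed
qed

lemma transpose_B_FE_mult: "transpose B_FE *v x = lower_part x"
proof (rule vec_eq_iff[THEN iffD2], rule allI)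
  fix j :: 'a
  have "(transpose B_FE *v x) $ j = (transpose (mat 1) *v lower_part x) $ j"
    by (simp add: B_FE_def transpose_def matrix_vector_mult_def sum_UNIV_Plus lower_part_def)
  thus "(transpose B_FE *v x) $ j = lower_part x $ j" by simp
qed

section \<open>Range of a symmetric matrix\<close>

lemma inner_transpose: "x \<bullet> (transpose A *v y) = (A *v x) \<bullet> y" for A :: "real^'n^'m"
  by (metis dot_lmul_matrix vector_transpose_matrix)

text \<open>The range of a symmetric matrix is the orthogonal complement of its kernel.\<close>

lemma symmetric_matrix_range:
  fixes M :: "real^'n^'n"
  assumes sym: "transpose M = M" and ker: "\<And>v. M *v v = 0 \<Longrightarrow> v \<bullet> y = 0"
  shows "y \<in> range ((*v) M)"
proof -
  obtain r n where r: "r \<in> span (range ((*v) M))"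
    and n: "\<And>w. w \<in> span (range ((*v) M)) \<Longrightarrow> orthogonal n w" and y: "y = r + n"
    by (rule orthogonal_subspace_decomp_exists[of "range ((*v) M)" y]) (rule that)
  have "n \<bullet> (M *v (M *v n)) = 0"
    using n[of "M *v (M *v n)"] by (simp add: orthogonal_def span_base)
  hence "M *v n = 0" using inner_transpose[of n M "M *v n"] sym by simp
  hence "n \<bullet> y = 0" by (rule ker)
  moreover have "n \<bullet> r = 0" using n[OF r] by (simp add: orthogonal_def)
  ultimately have "n = 0" by (simp add: y inner_add_right)
  have "span (range ((*v) M)) = range ((*v) M)"
    by (intro span_eq_iff[THEN iffD2] linear_subspace_image subspace_UNIV) simp
  with r have "r \<in> range ((*v) M)" by (simp only:)
  thus ?thesis unfolding y \<open>n = 0\<close> by (simp only: add_0_right)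
qed

text \<open>The linear choice of preimages keeps continuity in time: applied to a continuous curve in the
  range of \<open>M\<close>, it gives a continuous curve.\<close>

lemma matrix_generalized_inverse:
  fixes M :: "real^'n^'m"
  obtains g where "bounded_linear g" "\<And>y. y \<in> range ((*v) M) \<Longrightarrow> M *v g y = y"
proof -
  obtain g where "linear g" "\<forall>y\<in>range ((*v) M). M *v g y = y"
    using linear_exists_right_inverse_on[OF matrix_vector_mul_linear[of M] subspace_UNIV] by auto
  thus ?thesis using that linear_conv_bounded_linear by blast
qed

section \<open>Dissipation along solutions\<close>

lemma continuous_zero_if_integrals_zero:
  fixes f :: "real \<Rightarrow> real"
  assumes "0 < T" and f: "continuous_on {0..T} f"
    and zero: "\<And>t. t \<in> {0..T} \<Longrightarrow> integral {0..t} f = 0" and t: "t \<in> {0..T}"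
  shows "f t = 0"
proof (rule vector_derivative_unique_within_closed_interval[of 0 T t "\<lambda>u. integral {0..u} f"])
  show "((\<lambda>u. integral {0..u} f) has_vector_derivative f t) (at t within cbox 0 T)"
    using integral_has_vector_derivative[OF f t] by simp
  show "((\<lambda>u. integral {0..u} f) has_vector_derivative 0) (at t within cbox 0 T)"
    by (rule has_vector_derivative_transform[of t "cbox 0 T" "\<lambda>u. integral {0..u} f" "\<lambda>_. 0"])
      (use t zero in auto)
qed (use assms in auto)

text \<open>The subgradient inequalities at \<open>a\<close> and at \<open>b\<close> enclose \<open>W b - W a\<close> between \<open>G a \<bullet> (b - a)\<close> and
  \<open>G b \<bullet> (b - a)\<close>.\<close>

lemma continuous_on_if_subgradient:
  fixes W :: "'a::real_inner \<Rightarrow> real"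
  assumes sub: "\<And>a b. G a \<bullet> (b - a) \<le> W b - W a" and G: "continuous_on UNIV G"
  shows "continuous_on UNIV W"
proof (intro continuous_at_imp_continuous_on ballI)
  fix a
  have Ga: "(G \<longlongrightarrow> G a) (at a)"
    using G by (simp add: continuous_on_eq_continuous_at continuous_at)
  have "((\<lambda>b. W b - W a) \<longlongrightarrow> 0) (at a)"
  proof (rule tendsto_sandwich)
    show "\<forall>\<^sub>F b in at a. G a \<bullet> (b - a) \<le> W b - W a" using sub by simp
    have "W b - W a \<le> G b \<bullet> (b - a)" for b
      using sub[of b a] by (simp add: inner_diff_right)
    thus "\<forall>\<^sub>F b in at a. W b - W a \<le> G b \<bullet> (b - a)" by simp
    have "((\<lambda>b. G a \<bullet> (b - a)) \<longlongrightarrow> G a \<bullet> (a - a)) (at a)" by (intro tendsto_intros)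
    thus "((\<lambda>b. G a \<bullet> (b - a)) \<longlongrightarrow> 0) (at a)" by simp
    have "((\<lambda>b. G b \<bullet> (b - a)) \<longlongrightarrow> G a \<bullet> (a - a)) (at a)" by (intro tendsto_intros Ga)
    thus "((\<lambda>b. G b \<bullet> (b - a)) \<longlongrightarrow> 0) (at a)" by simp
  qed
  thus "isCont W a" by (simp add: isCont_def LIM_zero_iff)
qed

lemma L2_on_imp_absolutely_integrable:
  fixes u :: "real \<Rightarrow> 'b::euclidean_space"
  assumes u: "L2_on {a..b} u"
  shows "u absolutely_integrable_on {a..b}"
proof (rule set_integrable_bound)
  show "set_integrable lebesgue {a..b} (\<lambda>x. 1 + (norm (u x))\<^sup>2)"
    using u absolutely_integrable_continuous_real[of a b "\<lambda>_. 1 :: real"]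
    by (intro set_integral_add) (auto simp: L2_on_def)
  show "set_borel_measurable lebesgue {a..b} u" using u by (simp add: L2_on_def)
  have "norm (u x) \<le> 1 + (norm (u x))\<^sup>2" for x
    using sum_squares_bound[of 1 "norm (u x)"] norm_ge_zero[of "u x"]
    unfolding mult_1_right power_one by linarith
  thus "AE x in lebesgue. x \<in> {a..b} \<longrightarrow> norm (u x) \<le> norm (1 + (norm (u x))\<^sup>2)"
    by (intro AE_I2) (smt (verit) real_norm_def)
qed

text \<open>The balance of energy along a solution, with \<open>a\<close> and \<open>i\<close> the two parts of the state, \<open>f\<close> the weak
  derivative of \<open>E x\<close> and \<open>- h\<close> the first part of \<open>f\<close>. The costate \<open>p\<close> turns the subgradient bound for
  \<open>W\<close>, which involves the possibly non-differentiable \<open>a\<close>, into a bound by increments of \<open>E x\<close>.\<close>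

lemma dissipation_inequality:
  fixes M :: "real^'e^'e" and X :: "real^'m^'e" and R :: "real^'m^'m"
    and K :: "real^'e \<Rightarrow> real^'e^'e"
  assumes M_sym: "transpose M = M" and M_nonneg: "\<And>z. 0 \<le> z \<bullet> (M *v z)"
    and R_nonneg: "\<And>z. 0 \<le> z \<bullet> (R *v z)"
    and sub: "\<And>a b. (K a *v a) \<bullet> (b - a) \<le> W b - W a"
    and K: "continuous_on UNIV (\<lambda>a. K a *v a)"
    and "T > 0" and u: "L2_on {0..T} u"
    and sol: "solution (E_FE M X) (\<lambda>x. A_FE K X R x *v x) B_FE T x0 u x"
    and t: "0 \<le> t0" "t0 \<le> t1" "t1 \<le> T"
  shows "W (upper_part (x t1)) - W (upper_part (x t0))
    \<le> (LINT t:{t0..t1}|lebesgue. u t \<bullet> lower_part (x t))"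
proof -
  define a where "a t = upper_part (x t)" for t
  define i where "i t = lower_part (x t)" for t
  define h where "h t = K (a t) *v a t - X *v i t" for t
  have x: "continuous_on {0..T} x" using sol by (simp add: solution_def)
  have a_cont: "continuous_on {0..T} a"
    unfolding a_def by (rule bounded_linear.continuous_on[OF bounded_linear_upper_part x])
  have i_cont: "continuous_on {0..T} i"
    unfolding i_def by (rule bounded_linear.continuous_on[OF bounded_linear_lower_part x])
  have h_cont: "continuous_on {0..T} h"
    unfolding h_def
    by (intro continuous_on_diff continuous_on_compose2[OF K a_cont]
        bounded_linear.continuous_on[OF matrix_vector_mul_bounded_linear i_cont]) auto
  define f where "f t = join (- h t) (u t - R *v i t)" for t
  have f_eq: "f t = A_FE K X R (x t) *v x t + B_FE *v u t" for t
    unfolding A_FE_mult B_FE_mult f_def h_def a_def i_def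
    by (simp add: vec_eq_iff join_def split: sum.split)
  have f_int: "f absolutely_integrable_on {0..T}"
  proof -
    have "(\<lambda>t. join (- h t) (- (R *v i t))) absolutely_integrable_on {0..T}"
      by (intro absolutely_integrable_continuous_real continuous_on_join continuous_intros h_cont
          bounded_linear.continuous_on[OF matrix_vector_mul_bounded_linear i_cont])
    moreover have "(\<lambda>t. B_FE *v u t :: real^('e + 'm)) absolutely_integrable_on {0..T}"
      using absolutely_integrable_linear[OF L2_on_imp_absolutely_integrable[OF u]
          matrix_vector_mul_bounded_linear[of B_FE]] by (simp add: o_def)
    ultimately have "(\<lambda>t. join (- h t) (- (R *v i t)) + B_FE *v u t) absolutely_integrable_on {0..T}"
      by (rule set_integral_add)
    moreover have "join (- h t) (- (R *v i t)) + B_FE *v u t = f t" for t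
      unfolding B_FE_mult f_def by (simp add: vec_eq_iff join_def split: sum.split)
    ultimately show ?thesis by simp
  qed
  have incr: "E_FE M X *v x t - E_FE M X *v x s = integral {s..t} f"
    if "0 \<le> s" "s \<le> t" "t \<le> T" for s t
  proof (rule weak_derivative_increment[OF _ _ f_int that])
    show "has_weak_derivative {0<..<T} (\<lambda>t. E_FE M X *v x t) f"
      using sol unfolding solution_def f_eq[abs_def] by simp
    show "continuous_on {0..T} (\<lambda>t. E_FE M X *v x t)"
      by (rule bounded_linear.continuous_on[OF matrix_vector_mul_bounded_linear x])
  qed
  \<comment> \<open>For \<open>v\<close> in the kernel of \<open>M\<close>, the quantity \<open>v \<bullet> M a\<close> vanishes, and so does its derivative \<open>- v \<bullet> h\<close>.\<close>
  have h_range: "h t \<in> range ((*v) M)" if t: "t \<in> {0..T}" for t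
  proof (rule symmetric_matrix_range[OF M_sym])
    fix v assume v: "M *v v = 0"
    show "v \<bullet> h t = 0"
    proof (rule continuous_zero_if_integrals_zero[OF \<open>T > 0\<close> _ _ t, of "\<lambda>\<tau>. v \<bullet> h \<tau>"])
      show "continuous_on {0..T} (\<lambda>\<tau>. v \<bullet> h \<tau>)" by (intro continuous_intros h_cont)
      fix r assume r: "r \<in> {0..T}"
      have f_r: "f integrable_on {0..r}"
        using f_int r by (auto intro: integrable_subinterval_real simp: absolutely_integrable_on_def)
      have "integral {0..r} (\<lambda>\<tau>. join v 0 \<bullet> f \<tau>) = join v 0 \<bullet> integral {0..r} f"
        using integral_linear[OF f_r bounded_linear_inner_right[of "join v 0"]] by (simp add: o_def)
      also have "\<dots> = v \<bullet> (M *v (a r - a 0))"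
      proof -
        have "integral {0..r} f = E_FE M X *v x r - E_FE M X *v x 0" using incr[of 0 r] r by simp
        thus ?thesis
          by (simp add: E_FE_mult inner_diff_right inner_commute[of "join v 0"] inner_join a_def
              matrix_vector_mult_diff_distrib inner_commute[of _ v])
      qed
      also have "\<dots> = 0" using inner_transpose[of v M "a r - a 0"] M_sym v by simp
      finally have "integral {0..r} (\<lambda>\<tau>. - (v \<bullet> h \<tau>)) = 0" by (simp add: f_def inner_join)
      thus "integral {0..r} (\<lambda>\<tau>. v \<bullet> h \<tau>) = 0" by simp
    qed
  qed
  obtain g where g: "bounded_linear g" "\<And>y. y \<in> range ((*v) M) \<Longrightarrow> M *v g y = y"
    by (rule matrix_generalized_inverse[of M]) (rule that)
  have Mg: "M *v g (h t) = h t" if "t \<in> {0..T}" for t using g(2) h_range that by blast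
  \<comment> \<open>The costate: \<open>E\<^sup>T p = (M g(h) + X i, 0) = (K(a) a, 0)\<close>.\<close>
  define p where "p t = join (g (h t)) (i t)" for t
  have p_cont: "continuous_on {0..T} p"
    unfolding p_def by (intro continuous_on_join i_cont bounded_linear.continuous_on[OF g(1) h_cont])
  have W_le: "W (a t) - W (a s) \<le> p t \<bullet> integral {s..t} f" if st: "t0 \<le> s" "s \<le> t" "t \<le> t1" for s t
  proof -
    have t01: "t \<in> {0..T}" using st t by auto
    let ?d = "a t - a s"
    have "W (a t) - W (a s) \<le> (K (a t) *v a t) \<bullet> ?d"
      using sub[of "a t" "a s"] by (simp add: inner_diff_right)
    also have "\<dots> = (M *v g (h t)) \<bullet> ?d + (X *v i t) \<bullet> ?d"
      using Mg[OF t01] by (simp add: h_def inner_diff_left)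
    also have "\<dots> = g (h t) \<bullet> (M *v ?d) + i t \<bullet> (transpose X *v ?d)"
      using inner_transpose[of "g (h t)" M ?d] inner_transpose[of "i t" X ?d] M_sym by simp
    also have "\<dots> = p t \<bullet> (E_FE M X *v x t - E_FE M X *v x s)"
      by (simp add: E_FE_mult p_def inner_diff_right inner_join a_def matrix_vector_mult_diff_distrib)
    also have "\<dots> = p t \<bullet> integral {s..t} f" using incr[of s t] st t by simp
    finally show ?thesis .
  qed
  have f_int01: "f absolutely_integrable_on {t0..t1}"
    by (rule absolutely_integrable_on_subinterval[OF f_int]) (use t in auto)
  have cont01: "continuous_on {t0..t1} p" "continuous_on {t0..t1} i"
    using t by (auto intro: continuous_on_subset[OF p_cont] continuous_on_subset[OF i_cont])
  have ui: "(\<lambda>t. i t \<bullet> u t) absolutely_integrable_on {t0..t1}"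
    by (rule absolutely_integrable_inner_continuous[OF cont01(2) absolutely_integrable_on_subinterval
          [OF L2_on_imp_absolutely_integrable[OF u]]]) (use t in auto)
  have "W (a t1) - W (a t0) \<le> integral {t0..t1} (\<lambda>\<tau>. p \<tau> \<bullet> f \<tau>)"
    by (rule increment_le_integral_inner[OF cont01(1) f_int01 t(2), of "\<lambda>t. W (a t)"]) (rule W_le)
  also have "\<dots> \<le> integral {t0..t1} (\<lambda>\<tau>. i \<tau> \<bullet> u \<tau>)"
  proof (rule integral_le)
    show "(\<lambda>\<tau>. p \<tau> \<bullet> f \<tau>) integrable_on {t0..t1}"
      using absolutely_integrable_inner_continuous[OF cont01(1) f_int01]
      by (simp add: absolutely_integrable_on_def)
    show "(\<lambda>\<tau>. i \<tau> \<bullet> u \<tau>) integrable_on {t0..t1}" using ui by (simp add: absolutely_integrable_on_def)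
    fix \<tau> assume "\<tau> \<in> {t0..t1}"
    hence "\<tau> \<in> {0..T}" using t by auto
    hence "p \<tau> \<bullet> f \<tau> = - (g (h \<tau>) \<bullet> (M *v g (h \<tau>))) - i \<tau> \<bullet> (R *v i \<tau>) + i \<tau> \<bullet> u \<tau>"
      by (simp add: p_def f_def inner_join Mg inner_diff_right)
    thus "p \<tau> \<bullet> f \<tau> \<le> i \<tau> \<bullet> u \<tau>" using M_nonneg[of "g (h \<tau>)"] R_nonneg[of "i \<tau>"] by simp
  qed
  also have "\<dots> = (LINT t:{t0..t1}|lebesgue. u t \<bullet> i t)"
    using set_lebesgue_integral_eq_integral(2)[OF ui] by (simp add: inner_commute)
  finally show ?thesis by (simp add: a_def i_def)
qed

text \<open>Passivity in abstract form: an energy \<open>W\<close> with subgradient \<open>K a *v a\<close> is a storage function. It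
  is finite everywhere, so the extended real difference is an ordinary one.\<close>

lemma passive_if_convex_energy:
  fixes M :: "real^'e^'e" and X :: "real^'m^'e" and R :: "real^'m^'m"
    and K :: "real^'e \<Rightarrow> real^'e^'e"
  assumes M: "transpose M = M" "\<And>z. 0 \<le> z \<bullet> (M *v z)" and R: "\<And>z. 0 \<le> z \<bullet> (R *v z)"
    and W: "\<And>a. 0 \<le> W a" and sub: "\<And>a b. (K a *v a) \<bullet> (b - a) \<le> W b - W a"
    and K: "continuous_on UNIV (\<lambda>a. K a *v a)"
  shows "is_passive (E_FE M X) (\<lambda>x. A_FE K X R x *v x) B_FE (\<lambda>x. transpose B_FE *v x)"
  unfolding is_passive_def storage_function_def transpose_B_FE_mult
proof (intro exI[of _ "\<lambda>x. ennreal (W (upper_part x))"] conjI allI impI exI[of _ 0])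
  fix T :: real and x0 u x
  assume T: "T > 0" and *: "ennreal (W (upper_part x0)) < \<infinity> \<and> L2_on {0..T} u \<and>
    solution (E_FE M X) (\<lambda>x. A_FE K X R x *v x) B_FE T x0 u x \<and> L2_on {0..T} (\<lambda>t. lower_part (x t))"
  hence x: "continuous_on {0..T} x" by (simp add: solution_def)
  show "continuous_on {0..T} (\<lambda>t. ennreal (W (upper_part (x t))))"
    by (intro continuous_on_ennreal continuous_on_compose2[OF continuous_on_if_subgradient[of "\<lambda>a. K a *v a" W, OF sub K]]
        bounded_linear.continuous_on[OF bounded_linear_upper_part x]) simp
  fix t0 t1 assume t: "0 \<le> t0 \<and> t0 \<le> t1 \<and> t1 \<le> T"
  have "W (upper_part (x t1)) - W (upper_part (x t0)) \<le> (LINT t:{t0..t1}|lebesgue. u t \<bullet> lower_part (x t))"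
    using * t by (intro dissipation_inequality[OF M R sub K T]) auto
  thus "enn2ereal (ennreal (W (upper_part (x t1)))) - enn2ereal (ennreal (W (upper_part (x t0))))
      \<le> ereal (LINT t:{t0..t1}|lebesgue. u t \<bullet> lower_part (x t))"
    by (simp add: enn2ereal_ennreal W)
qed simp

section \<open>Magnetic material laws\<close>

text \<open>The bound on \<open>\<nu>\<close> itself is required besides the Lipschitz condition on \<open>\<zeta> \<mapsto> \<nu> \<zeta> * \<zeta>\<close>, since the
  latter leaves the value \<open>\<nu> 0\<close> free, while the entries of the stiffness matrix also involve the
  points at which the field vanishes.\<close>

definition magnetic_law :: "real \<Rightarrow> (real \<Rightarrow> real) \<Rightarrow> bool" where
  "magnetic_law L \<nu> \<longleftrightarrow> (\<forall>\<zeta>\<ge>0. 0 \<le> \<nu> \<zeta> \<and> \<nu> \<zeta> \<le> L) \<and> mono_on {0..} (\<lambda>\<zeta>. \<nu> \<zeta> * \<zeta>) \<and>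
     L-lipschitz_on {0..} (\<lambda>\<zeta>. \<nu> \<zeta> * \<zeta>)"

definition energy_density :: "(real \<Rightarrow> real) \<Rightarrow> real \<Rightarrow> real" where
  "energy_density \<nu> \<rho> = integral {0..\<rho>} (\<lambda>\<zeta>. \<nu> \<zeta> * \<zeta>)"

lemma magnetic_law_integrable:
  assumes "magnetic_law L \<nu>" "0 \<le> a"
  shows "(\<lambda>\<zeta>. \<nu> \<zeta> * \<zeta>) integrable_on {a..b}"
proof (rule integrable_continuous_real)
  have "continuous_on {0..} (\<lambda>\<zeta>. \<nu> \<zeta> * \<zeta>)"
    using assms(1) by (auto simp: magnetic_law_def intro: lipschitz_on_continuous_on)
  thus "continuous_on {a..b} (\<lambda>\<zeta>. \<nu> \<zeta> * \<zeta>)"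
    by (rule continuous_on_subset) (use assms(2) in auto)
qed

text \<open>The density is an antiderivative of a nondecreasing function, hence convex: the integral of
  \<open>\<nu> \<zeta> * \<zeta>\<close> between \<open>\<rho>\<close> and \<open>r\<close> is compared with its value at \<open>\<rho>\<close> times the length.\<close>

lemma energy_density_subgradient:
  assumes law: "magnetic_law L \<nu>" and "0 \<le> \<rho>" "0 \<le> r"
  shows "\<nu> \<rho> * \<rho> * (r - \<rho>) \<le> energy_density \<nu> r - energy_density \<nu> \<rho>"
proof -
  let ?f = "\<lambda>\<zeta>. \<nu> \<zeta> * \<zeta>"
  have mono: "?f x \<le> ?f y" if "0 \<le> x" "x \<le> y" for x y
  proof -
    have "mono_on {0..} ?f" using law by (simp add: magnetic_law_def)
    from mono_onD[OF this, of x y] that show ?thesis by simp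
  qed
  note int = magnetic_law_integrable[OF law]
  have split: "integral {0..x} ?f + integral {x..y} ?f = integral {0..y} ?f" if "0 \<le> x" "x \<le> y" for x y
    using that by (intro Henstock_Kurzweil_Integration.integral_combine int) auto
  show ?thesis
  proof (cases "\<rho> \<le> r")
    case True
    have "integral {\<rho>..r} (\<lambda>_. ?f \<rho>) \<le> integral {\<rho>..r} ?f"
      using assms mono by (intro integral_le int) auto
    thus ?thesis using split[of \<rho> r] True assms by (simp add: energy_density_def algebra_simps)
  next
    case False
    have "integral {r..\<rho>} ?f \<le> integral {r..\<rho>} (\<lambda>_. ?f \<rho>)"
      using assms mono by (intro integral_le int) auto
    thus ?thesis using split[of r \<rho>] False assms by (simp add: energy_density_def algebra_simps)
  qed
qed

lemma energy_density_0 [simp]: "energy_density \<nu> 0 = 0"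
  by (simp add: energy_density_def)

lemma energy_density_nonneg:
  assumes "magnetic_law L \<nu>"
  shows "0 \<le> energy_density \<nu> \<rho>"
  unfolding energy_density_def
  using assms by (intro integral_nonneg magnetic_law_integrable) (auto simp: magnetic_law_def)

lemma energy_density_le:
  assumes "magnetic_law L \<nu>" "0 \<le> \<rho>"
  shows "energy_density \<nu> \<rho> \<le> L * \<rho>\<^sup>2"
proof -
  have "energy_density \<nu> \<rho> \<le> \<nu> \<rho> * \<rho>\<^sup>2"
    using energy_density_subgradient[OF assms(1,2), of 0] by (simp add: power2_eq_square)
  also have "\<dots> \<le> L * \<rho>\<^sup>2"
    using assms by (intro mult_right_mono) (auto simp: magnetic_law_def)
  finally show ?thesis .
qed

text \<open>For negative arguments the integral is over an empty interval, so the density is monotone on the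
  whole line.\<close>

lemma energy_density_measurable:
  assumes "magnetic_law L \<nu>"
  shows "energy_density \<nu> \<in> borel_measurable borel"
proof (rule borel_measurable_mono, rule monoI)
  fix x y :: real assume "x \<le> y"
  show "energy_density \<nu> x \<le> energy_density \<nu> y"
  proof (cases "0 \<le> x")
    case True
    have "0 \<le> \<nu> x * x * (y - x)" using assms \<open>x \<le> y\<close> True by (simp add: magnetic_law_def)
    also note energy_density_subgradient[OF assms True order_trans[OF True \<open>x \<le> y\<close>]]
    finally show ?thesis by simp
  next
    case False
    hence "energy_density \<nu> x = 0" by (simp add: energy_density_def)
    thus ?thesis using energy_density_nonneg[OF assms] by simp
  qed
qed

text \<open>Convexity in the vector variable: the Cauchy--Schwarz inequality bounds \<open>v \<bullet> (w - v)\<close> by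
  \<open>norm v * (norm w - norm v)\<close>, and \<open>\<nu> \<ge> 0\<close> preserves the inequality, which reduces the claim to the
  scalar case.\<close>

lemma energy_density_norm_subgradient:
  fixes v w :: "'a::real_inner"
  assumes law: "magnetic_law L \<nu>"
  shows "\<nu> (norm v) * (v \<bullet> (w - v)) \<le> energy_density \<nu> (norm w) - energy_density \<nu> (norm v)"
proof -
  have "\<nu> (norm v) * (v \<bullet> (w - v)) \<le> \<nu> (norm v) * (norm v * (norm w - norm v))"
    using law norm_cauchy_schwarz[of v w]
    by (intro mult_left_mono)
      (auto simp: magnetic_law_def inner_diff_right right_diff_distrib power2_norm_eq_inner[symmetric] power2_eq_square)
  also have "\<dots> = \<nu> (norm v) * norm v * (norm w - norm v)" by simp
  also have "\<dots> \<le> energy_density \<nu> (norm w) - energy_density \<nu> (norm v)"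
    by (rule energy_density_subgradient[OF law]) auto
  finally show ?thesis .
qed

text \<open>Split the difference as \<open>\<nu>(\<parallel>v\<parallel>)(v - w) + (\<nu>(\<parallel>v\<parallel>) - \<nu>(\<parallel>w\<parallel>)) w\<close>. The second summand has norm
  \<open>\<bar>(\<nu>(\<parallel>v\<parallel>)\<parallel>v\<parallel> - \<nu>(\<parallel>w\<parallel>)\<parallel>w\<parallel>) - \<nu>(\<parallel>v\<parallel>)(\<parallel>v\<parallel> - \<parallel>w\<parallel>)\<bar>\<close>, which is at most \<open>2 L \<parallel>v - w\<parallel>\<close>.\<close>

lemma magnetic_field_lipschitz:
  fixes v w :: "'a::real_inner"
  assumes law: "magnetic_law L \<nu>"
  shows "norm (\<nu> (norm v) *\<^sub>R v - \<nu> (norm w) *\<^sub>R w) \<le> 3 * L * norm (v - w)"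
proof -
  let ?f = "\<lambda>\<zeta>. \<nu> \<zeta> * \<zeta>"
  have \<nu>: "0 \<le> \<nu> (norm v)" "\<nu> (norm v) \<le> L" using law by (auto simp: magnetic_law_def)
  have tri: "\<bar>norm v - norm w\<bar> \<le> norm (v - w)" by (rule norm_triangle_ineq3)
  have "\<bar>?f (norm v) - ?f (norm w)\<bar> \<le> L * \<bar>norm v - norm w\<bar>"
    using law lipschitz_onD[of L "{0..}" ?f "norm v" "norm w"]
    by (auto simp: magnetic_law_def dist_real_def)
  also have "\<dots> \<le> L * norm (v - w)" using \<nu> tri by (intro mult_left_mono) auto
  finally have 1: "\<bar>?f (norm v) - ?f (norm w)\<bar> \<le> L * norm (v - w)" .
  have 2: "\<nu> (norm v) * \<bar>norm v - norm w\<bar> \<le> L * norm (v - w)"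
    using \<nu> tri by (intro mult_mono) auto
  have 3: "\<nu> (norm v) * norm (v - w) \<le> L * norm (v - w)"
    using \<nu> by (intro mult_right_mono) auto
  have "norm ((\<nu> (norm v) - \<nu> (norm w)) *\<^sub>R w) = \<bar>(\<nu> (norm v) - \<nu> (norm w)) * norm w\<bar>"
    by (simp add: abs_mult)
  also have "\<dots> = \<bar>(?f (norm v) - ?f (norm w)) - \<nu> (norm v) * (norm v - norm w)\<bar>"
    by (simp add: algebra_simps)
  also have "\<dots> \<le> L * norm (v - w) + L * norm (v - w)"
  proof -
    have "\<bar>\<nu> (norm v) * (norm v - norm w)\<bar> \<le> L * norm (v - w)"
      using 2 \<nu>(1) by (simp add: abs_mult)
    with 1 show ?thesis by linarith
  qed
  finally have "norm ((\<nu> (norm v) - \<nu> (norm w)) *\<^sub>R w) \<le> 2 * L * norm (v - w)" by simp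
  moreover have "\<nu> (norm v) *\<^sub>R v - \<nu> (norm w) *\<^sub>R w
      = \<nu> (norm v) *\<^sub>R (v - w) + (\<nu> (norm v) - \<nu> (norm w)) *\<^sub>R w"
    by (simp add: algebra_simps)
  ultimately show ?thesis
    using norm_triangle_ineq[of "\<nu> (norm v) *\<^sub>R (v - w)" "(\<nu> (norm v) - \<nu> (norm w)) *\<^sub>R w"] 3 \<nu>(1)
    by simp
qed

lemma magnetic_law_mono: "magnetic_law L \<nu> \<Longrightarrow> L \<le> L' \<Longrightarrow> magnetic_law L' \<nu>"
  unfolding magnetic_law_def using lipschitz_on_mono by fastforce

lemma magnetic_law_const: "0 \<le> c \<Longrightarrow> magnetic_law c (\<lambda>_. c)"
  unfolding magnetic_law_def
  by (auto intro!: mono_onI mult_left_mono lipschitz_onI simp: dist_real_def abs_mult simp flip: right_diff_distrib)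

text \<open>Comparing with \<open>\<zeta> = 0\<close> in the Lipschitz condition gives \<open>\<nu> \<zeta> \<le> L\<close> for \<open>\<zeta> > 0\<close> only, hence the
  maximum with \<open>\<nu> 0\<close>.\<close>

lemma magnetic_law_strongly_monotone:
  assumes nonneg: "\<forall>\<zeta>\<ge>0. \<nu> \<zeta> \<ge> 0" and "m > 0" and sm: "strongly_monotone_on m {0..} (\<lambda>\<zeta>. \<nu> \<zeta> * \<zeta>)"
    and lip: "L-lipschitz_on {0..} (\<lambda>\<zeta>. \<nu> \<zeta> * \<zeta>)"
  shows "magnetic_law (max L (\<nu> 0)) \<nu>"
proof -
  have "\<nu> \<zeta> \<le> max L (\<nu> 0)" if "\<zeta> \<ge> 0" for \<zeta>
  proof (cases "\<zeta> = 0")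
    case False
    have "\<bar>\<nu> \<zeta> * \<zeta>\<bar> \<le> L * \<bar>\<zeta>\<bar>" using lipschitz_onD[OF lip, of \<zeta> 0] that by (simp add: dist_real_def)
    thus ?thesis using False that by (simp add: abs_mult)
  qed simp
  moreover have "\<nu> x * x \<le> \<nu> y * y" if "0 \<le> x" "x \<le> y" for x y
  proof (cases "x = y")
    case False
    have "0 \<le> m * (y - x)\<^sup>2" using \<open>m > 0\<close> by simp
    also have "\<dots> \<le> (\<nu> y * y - \<nu> x * x) * (y - x)" using sm that by (simp add: strongly_monotone_on_def)
    finally show ?thesis using that False by (simp add: zero_le_mult_iff)
  qed simp
  ultimately show ?thesis
    using nonneg lipschitz_on_mono[OF lip, of "{0..}" "max L (\<nu> 0)"]
    unfolding magnetic_law_def by (auto intro!: mono_onI)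
qed

section \<open>Square-integrable fields and weighted Gram matrices\<close>

lemma L2_on_norm: "L2_on S f \<Longrightarrow> L2_on S (\<lambda>x. norm (f x))"
proof -
  assume f: "L2_on S f"
  have "(\<lambda>x. indicator S x *\<^sub>R norm (f x)) = (\<lambda>x. norm (indicator S x *\<^sub>R f x))"
    by (auto simp: fun_eq_iff indicator_def)
  thus ?thesis
    using f measurable_compose[OF _ borel_measurable_norm, of "\<lambda>x. indicator S x *\<^sub>R f x" lebesgue]
    by (simp add: L2_on_def set_borel_measurable_def)
qed

lemma L2_on_weighted_inner_integrable:
  fixes f g :: "'a::euclidean_space \<Rightarrow> 'b::euclidean_space"
  assumes f: "L2_on S f" and g: "L2_on S g"
    and w: "w \<in> borel_measurable lebesgue" and w_le: "\<And>x. \<bar>w x\<bar> \<le> B"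
  shows "set_integrable lebesgue S (\<lambda>x. w x * (f x \<bullet> g x))"
proof (rule set_integrable_bound)
  show "set_integrable lebesgue S (\<lambda>x. B * ((norm (f x))\<^sup>2 + (norm (g x))\<^sup>2))"
    using f g by (intro set_integrable_mult_right set_integral_add) (auto simp: L2_on_def)
  have "(\<lambda>x. indicator S x *\<^sub>R (w x * (f x \<bullet> g x)))
      = (\<lambda>x. w x * ((indicator S x *\<^sub>R f x) \<bullet> (indicator S x *\<^sub>R g x)))"
    by (auto simp: fun_eq_iff indicator_def)
  moreover have "(\<lambda>x. indicator S x *\<^sub>R f x) \<in> borel_measurable lebesgue"
    "(\<lambda>x. indicator S x *\<^sub>R g x) \<in> borel_measurable lebesgue"
    using f g by (auto simp: L2_on_def set_borel_measurable_def)
  ultimately show "set_borel_measurable lebesgue S (\<lambda>x. w x * (f x \<bullet> g x))"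
    using w unfolding set_borel_measurable_def
    by (simp only: borel_measurable_times borel_measurable_inner)
  have "\<bar>w x * (f x \<bullet> g x)\<bar> \<le> B * ((norm (f x))\<^sup>2 + (norm (g x))\<^sup>2)" for x
  proof -
    have "\<bar>f x \<bullet> g x\<bar> \<le> norm (f x) * norm (g x)" by (rule Cauchy_Schwarz_ineq2)
    also have "\<dots> \<le> (norm (f x))\<^sup>2 + (norm (g x))\<^sup>2"
    proof -
      have "2 * (norm (f x) * norm (g x)) \<le> (norm (f x))\<^sup>2 + (norm (g x))\<^sup>2"
        using sum_squares_bound[of "norm (f x)" "norm (g x)"] by (simp add: mult.assoc)
      moreover have "0 \<le> norm (f x) * norm (g x)" by simp
      ultimately show ?thesis by linarith
    qed
    finally show ?thesis
      unfolding abs_mult using w_le[of x] by (intro mult_mono) auto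
  qed
  thus "AE x in lebesgue. x \<in> S \<longrightarrow> norm (w x * (f x \<bullet> g x))
      \<le> norm (B * ((norm (f x))\<^sup>2 + (norm (g x))\<^sup>2))"
    by (intro AE_I2) (smt (verit) real_norm_def)
qed

lemma L2_on_inner_integrable:
  fixes f g :: "'a::euclidean_space \<Rightarrow> 'b::euclidean_space"
  shows "L2_on S f \<Longrightarrow> L2_on S g \<Longrightarrow> set_integrable lebesgue S (\<lambda>x. f x \<bullet> g x)"
  using L2_on_weighted_inner_integrable[of S f g "\<lambda>_. 1" 1] by simp

lemma L2_on_norm_mult_integrable:
  assumes "L2_on S f" "L2_on S g"
  shows "set_integrable lebesgue S (\<lambda>x. norm (f x) * norm (g x))"
  using L2_on_inner_integrable[OF L2_on_norm L2_on_norm, OF assms] by simp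

lemma L2_on_scaleR: "L2_on S f \<Longrightarrow> L2_on S (\<lambda>x. r *\<^sub>R f x)"
proof -
  assume f: "L2_on S f"
  have "(\<lambda>x. indicator S x *\<^sub>R r *\<^sub>R f x) = (\<lambda>x. r *\<^sub>R (indicator S x *\<^sub>R f x))"
    by (auto simp: fun_eq_iff)
  thus ?thesis
    using f borel_measurable_scaleR[of "\<lambda>_. r" lebesgue "\<lambda>x. indicator S x *\<^sub>R f x"]
    by (auto simp: L2_on_def set_borel_measurable_def power_mult_distrib)
qed

lemma L2_on_add:
  fixes f g :: "'a::euclidean_space \<Rightarrow> 'b::euclidean_space"
  assumes f: "L2_on S f" and g: "L2_on S g"
  shows "L2_on S (\<lambda>x. f x + g x)"
proof -
  have "(\<lambda>x. indicator S x *\<^sub>R (f x + g x)) = (\<lambda>x. indicator S x *\<^sub>R f x + indicator S x *\<^sub>R g x)"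
    by (auto simp: fun_eq_iff scaleR_add_right)
  hence "set_borel_measurable lebesgue S (\<lambda>x. f x + g x)"
    using f g by (auto simp: L2_on_def set_borel_measurable_def intro: borel_measurable_add)
  moreover have "(\<lambda>x. (norm (f x + g x))\<^sup>2)
      = (\<lambda>x. (norm (f x))\<^sup>2 + 2 * (f x \<bullet> g x) + (norm (g x))\<^sup>2)"
    by (auto simp: fun_eq_iff power2_norm_eq_inner algebra_simps inner_commute)
  moreover have "set_integrable lebesgue S (\<lambda>x. (norm (f x))\<^sup>2 + 2 * (f x \<bullet> g x) + (norm (g x))\<^sup>2)"
    using f g L2_on_inner_integrable[OF f g]
    by (intro set_integral_add set_integrable_mult_right) (auto simp: L2_on_def)
  ultimately show ?thesis by (simp add: L2_on_def)
qed

lemma L2_on_sum: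
  fixes c :: "'e \<Rightarrow> 'a::euclidean_space \<Rightarrow> 'b::euclidean_space"
  assumes "finite I" "\<And>k. k \<in> I \<Longrightarrow> L2_on S (c k)"
  shows "L2_on S (\<lambda>x. \<Sum>k\<in>I. c k x)"
  using assms
proof (induction I rule: finite_induct)
  case empty
  show ?case by (simp add: L2_on_def set_borel_measurable_def set_integrable_def)
next
  case (insert k I)
  thus ?case using L2_on_add[of S "c k" "\<lambda>x. \<Sum>k\<in>I. c k x"] by simp
qed

lemma set_lebesgue_integral_sum:
  fixes f :: "'e \<Rightarrow> 'a \<Rightarrow> real"
  assumes "finite I" "\<And>k. k \<in> I \<Longrightarrow> set_integrable M S (f k)"
  shows "set_integrable M S (\<lambda>x. \<Sum>k\<in>I. f k x)"
    and "(LINT x:S|M. \<Sum>k\<in>I. f k x) = (\<Sum>k\<in>I. LINT x:S|M. f k x)"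
  using assms unfolding set_integrable_def set_lebesgue_integral_def
  by (simp_all only: scaleR_sum_right Bochner_Integration.integrable_sum Bochner_Integration.integral_sum)

definition fe_field :: "('e::finite \<Rightarrow> 'a \<Rightarrow> 'b::real_vector) \<Rightarrow> real^'e \<Rightarrow> 'a \<Rightarrow> 'b" where
  "fe_field c a \<xi> = (\<Sum>k\<in>UNIV. a $ k *\<^sub>R c k \<xi>)"

lemma fe_field_diff: "fe_field c (a - b) \<xi> = fe_field c a \<xi> - fe_field c b \<xi>"
  by (simp add: fe_field_def sum_subtractf scaleR_diff_left)

lemma fe_field_axis: "fe_field c (axis k 1) \<xi> = c k \<xi>"
proof -
  have "fe_field c (axis k 1) \<xi> = (\<Sum>j\<in>UNIV. if j = k then c j \<xi> else 0)"
    unfolding fe_field_def by (rule sum.cong) (auto simp: axis_def)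
  thus ?thesis by simp
qed

lemma L2_on_fe_field: "(\<And>k. L2_on S (c k)) \<Longrightarrow> L2_on S (fe_field c a)"
  unfolding fe_field_def by (intro L2_on_sum L2_on_scaleR) auto

text \<open>A mass matrix is a Gram matrix with weight \<open>w\<close>. The fields \<open>c\<close> may be the basis functions or their
  curls; in the second case the weight is the reluctivity and the matrix is the stiffness matrix.\<close>

lemma mass_matrix_bilinear_form:
  fixes c :: "'e::finite \<Rightarrow> real^3 \<Rightarrow> real^3"
  assumes c: "\<And>k. L2_on \<Omega> (c k)"
    and w: "w \<in> borel_measurable lebesgue" and w_le: "\<And>\<xi>. \<bar>w \<xi>\<bar> \<le> B"
  shows "b \<bullet> (mass_matrix \<Omega> w c *v a) = (LINT \<xi>:\<Omega>|lebesgue. w \<xi> * (fe_field c a \<xi> \<bullet> fe_field c b \<xi>))"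
proof -
  have expand: "w \<xi> * (fe_field c a \<xi> \<bullet> fe_field c b \<xi>)
      = (\<Sum>k\<in>UNIV. \<Sum>l\<in>UNIV. (b $ k * a $ l) * (w \<xi> * (c l \<xi> \<bullet> c k \<xi>)))" for \<xi>
    unfolding fe_field_def inner_sum_left inner_sum_right
    by (simp add: sum_distrib_left mult_ac)
  have int: "set_integrable lebesgue \<Omega> (\<lambda>\<xi>. w \<xi> * (c l \<xi> \<bullet> c k \<xi>))" for k l
    using L2_on_weighted_inner_integrable[OF c c w w_le] .
  have "(LINT \<xi>:\<Omega>|lebesgue. w \<xi> * (fe_field c a \<xi> \<bullet> fe_field c b \<xi>))
      = (\<Sum>k\<in>UNIV. \<Sum>l\<in>UNIV. (b $ k * a $ l) * (LINT \<xi>:\<Omega>|lebesgue. w \<xi> * (c l \<xi> \<bullet> c k \<xi>)))"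
    unfolding expand
    by (subst set_lebesgue_integral_sum, simp, intro set_lebesgue_integral_sum(1), simp, simp add: int,
        rule sum.cong, simp, subst set_lebesgue_integral_sum, simp, simp add: int, simp)
  also have "\<dots> = b \<bullet> (mass_matrix \<Omega> w c *v a)"
    by (simp add: inner_vec_def matrix_vector_mult_def mass_matrix_def sum_distrib_left mult_ac)
  finally show ?thesis by simp
qed

lemma transpose_mass_matrix: "transpose (mass_matrix \<Omega> w c) = mass_matrix \<Omega> w c"
  by (simp add: transpose_def mass_matrix_def inner_commute)

lemma mass_matrix_nonneg:
  fixes c :: "'e::finite \<Rightarrow> real^3 \<Rightarrow> real^3"
  assumes c: "\<And>k. L2_on \<Omega> (c k)"
    and w: "w \<in> borel_measurable lebesgue" and w_bds: "\<And>\<xi>. 0 \<le> w \<xi> \<and> w \<xi> \<le> B"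
  shows "0 \<le> a \<bullet> (mass_matrix \<Omega> w c *v a)"
proof -
  have "\<bar>w \<xi>\<bar> \<le> B" for \<xi> using w_bds[of \<xi>] by simp
  from mass_matrix_bilinear_form[where c = c, OF c w this] show ?thesis
    using w_bds by (auto simp: set_lebesgue_integral_def intro!: integral_nonneg_AE AE_I2 mult_nonneg_nonneg)
qed

section \<open>The magnetic energy\<close>

lemma borel_measurable_fe_field:
  assumes "\<And>k. L2_on S (c k)"
  shows "(\<lambda>\<xi>. indicator S \<xi> *\<^sub>R fe_field c a \<xi>) \<in> borel_measurable lebesgue"
  using L2_on_fe_field[of S c a, OF assms] by (simp add: L2_on_def set_borel_measurable_def)

text \<open>The spatial dependence of \<open>\<nu>\<close> enters through measurability after composition with a field strength
  \<open>r\<close>, the form in which reluctivity and density are integrated.\<close>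

locale magnetic_energy =
  fixes \<Omega> :: "(real^3) set" and \<nu> :: "real^3 \<Rightarrow> real \<Rightarrow> real" and L :: real
    and c :: "'e::finite \<Rightarrow> real^3 \<Rightarrow> real^3"
  assumes law: "\<And>\<xi>. magnetic_law L (\<nu> \<xi>)"
    and reluctivity_measurable: "\<And>r. r \<in> borel_measurable lebesgue \<Longrightarrow> (\<And>\<xi>. 0 \<le> r \<xi>) \<Longrightarrow>
      (\<lambda>\<xi>. \<nu> \<xi> (r \<xi>)) \<in> borel_measurable lebesgue"
    and density_measurable: "\<And>r. r \<in> borel_measurable lebesgue \<Longrightarrow>
      (\<lambda>\<xi>. energy_density (\<nu> \<xi>) (r \<xi>)) \<in> borel_measurable lebesgue"
    and L2: "\<And>k. L2_on \<Omega> (c k)"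
begin

text \<open>The field strength cut off outside \<open>\<Omega>\<close>. Square integrability on \<open>\<Omega>\<close> gives measurability only
  after multiplication by the indicator function; with the cut-off, the weights below are measurable
  on the whole space.\<close>

definition strength :: "real^'e \<Rightarrow> real^3 \<Rightarrow> real" where
  "strength a \<xi> = indicator \<Omega> \<xi> * norm (fe_field c a \<xi>)"

definition stiffness :: "real^'e \<Rightarrow> real^'e^'e" where
  "stiffness a = mass_matrix \<Omega> (\<lambda>\<xi>. \<nu> \<xi> (norm (fe_field c a \<xi>))) c"

definition energy :: "real^'e \<Rightarrow> real" where
  "energy a = (LINT \<xi>:\<Omega>|lebesgue. energy_density (\<nu> \<xi>) (norm (fe_field c a \<xi>)))"

lemma strength_measurable: "strength a \<in> borel_measurable lebesgue"
proof -
  have "strength a = (\<lambda>\<xi>. norm (indicator \<Omega> \<xi> *\<^sub>R fe_field c a \<xi>))"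
    by (auto simp: strength_def fun_eq_iff indicator_def)
  thus ?thesis
    using measurable_compose[OF borel_measurable_fe_field[of \<Omega> c, OF L2] borel_measurable_norm] by simp
qed

lemma strength_nonneg: "0 \<le> strength a \<xi>"
  by (simp add: strength_def)

lemma reluctivity_bounds: "0 \<le> \<nu> \<xi> (strength a \<xi>) \<and> \<nu> \<xi> (strength a \<xi>) \<le> L"
  using law[of \<xi>] strength_nonneg[of a \<xi>] by (simp add: magnetic_law_def)

lemma stiffness_eq: "stiffness a = mass_matrix \<Omega> (\<lambda>\<xi>. \<nu> \<xi> (strength a \<xi>)) c"
  unfolding stiffness_def mass_matrix_def
  by (intro vec_eq_iff[THEN iffD2] allI) (auto simp: set_lebesgue_integral_def strength_def indicator_def
      intro!: Bochner_Integration.integral_cong)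

lemma energy_eq: "energy a = (LINT \<xi>:\<Omega>|lebesgue. energy_density (\<nu> \<xi>) (strength a \<xi>))"
  unfolding energy_def
  by (auto simp: set_lebesgue_integral_def strength_def indicator_def intro!: Bochner_Integration.integral_cong)

lemma weight_measurable: "(\<lambda>\<xi>. \<nu> \<xi> (strength a \<xi>)) \<in> borel_measurable lebesgue"
  by (intro reluctivity_measurable strength_measurable strength_nonneg)

lemma weight_le: "\<bar>\<nu> \<xi> (strength a \<xi>)\<bar> \<le> L"
  using reluctivity_bounds[of \<xi> a] by simp

text \<open>The nonlinear force \<open>stiffness a *v a\<close>, tested with \<open>b\<close>.\<close>

lemma stiffness_form:
  "b \<bullet> (stiffness a *v a)
     = (LINT \<xi>:\<Omega>|lebesgue. \<nu> \<xi> (strength a \<xi>) * (fe_field c a \<xi> \<bullet> fe_field c b \<xi>))"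
  and stiffness_form_integrable:
  "set_integrable lebesgue \<Omega> (\<lambda>\<xi>. \<nu> \<xi> (strength a \<xi>) * (fe_field c a \<xi> \<bullet> fe_field c b \<xi>))"
  unfolding stiffness_eq
  by (rule mass_matrix_bilinear_form[OF L2 weight_measurable weight_le])
    (rule L2_on_weighted_inner_integrable[OF L2_on_fe_field[OF L2] L2_on_fe_field[OF L2] weight_measurable weight_le])

lemma energy_integrable:
  "set_integrable lebesgue \<Omega> (\<lambda>\<xi>. energy_density (\<nu> \<xi>) (strength a \<xi>))"
proof (rule set_integrable_bound)
  show "set_integrable lebesgue \<Omega> (\<lambda>\<xi>. L * (norm (fe_field c a \<xi>))\<^sup>2)"
    using L2_on_fe_field[of \<Omega> c a, OF L2] by (intro set_integrable_mult_right) (simp add: L2_on_def)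
  have "(\<lambda>\<xi>. indicator \<Omega> \<xi> *\<^sub>R energy_density (\<nu> \<xi>) (strength a \<xi>))
      = (\<lambda>\<xi>. energy_density (\<nu> \<xi>) (strength a \<xi>))"
    by (auto simp: fun_eq_iff strength_def indicator_def)
  thus "set_borel_measurable lebesgue \<Omega> (\<lambda>\<xi>. energy_density (\<nu> \<xi>) (strength a \<xi>))"
    unfolding set_borel_measurable_def using density_measurable[OF strength_measurable] by simp
  show "AE \<xi> in lebesgue. \<xi> \<in> \<Omega> \<longrightarrow> norm (energy_density (\<nu> \<xi>) (strength a \<xi>))
      \<le> norm (L * (norm (fe_field c a \<xi>))\<^sup>2)"
  proof (intro AE_I2 impI)
    fix \<xi> assume "\<xi> \<in> \<Omega>"
    thus "norm (energy_density (\<nu> \<xi>) (strength a \<xi>)) \<le> norm (L * (norm (fe_field c a \<xi>))\<^sup>2)"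
      using energy_density_le[OF law[of \<xi>], of "strength a \<xi>"] energy_density_nonneg[OF law[of \<xi>], of "strength a \<xi>"]
      by (simp add: strength_def)
  qed
qed

lemma energy_nonneg: "0 \<le> energy a"
  unfolding energy_eq set_lebesgue_integral_def
  using energy_density_nonneg[OF law] by (intro integral_nonneg_AE AE_I2) simp

text \<open>Integrate the pointwise convexity inequality of the density. This is where \<open>stiffness a *v a\<close>
  appears as the gradient of the energy.\<close>

lemma energy_subgradient: "(stiffness a *v a) \<bullet> (b - a) \<le> energy b - energy a"
proof -
  have "(stiffness a *v a) \<bullet> (b - a)
      = (LINT \<xi>:\<Omega>|lebesgue. \<nu> \<xi> (strength a \<xi>) * (fe_field c a \<xi> \<bullet> fe_field c (b - a) \<xi>))"
    by (simp add: inner_commute[of "stiffness a *v a"] stiffness_form)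
  also have "\<dots> \<le> (LINT \<xi>:\<Omega>|lebesgue. energy_density (\<nu> \<xi>) (strength b \<xi>) - energy_density (\<nu> \<xi>) (strength a \<xi>))"
  proof (rule set_integral_mono)
    show "set_integrable lebesgue \<Omega> (\<lambda>\<xi>. energy_density (\<nu> \<xi>) (strength b \<xi>) - energy_density (\<nu> \<xi>) (strength a \<xi>))"
      by (intro set_integral_diff energy_integrable)
    show "\<nu> \<xi> (strength a \<xi>) * (fe_field c a \<xi> \<bullet> fe_field c (b - a) \<xi>)
        \<le> energy_density (\<nu> \<xi>) (strength b \<xi>) - energy_density (\<nu> \<xi>) (strength a \<xi>)" if "\<xi> \<in> \<Omega>" for \<xi>
      using energy_density_norm_subgradient[OF law[of \<xi>], of "fe_field c a \<xi>" "fe_field c b \<xi>"] that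
      by (simp add: strength_def fe_field_diff)
  qed (rule stiffness_form_integrable)
  also have "\<dots> = energy b - energy a"
    unfolding energy_eq by (intro set_integral_diff energy_integrable)
  finally show ?thesis .
qed

text \<open>The pointwise Lipschitz bound for \<open>v \<mapsto> \<nu>(\<parallel>v\<parallel>) v\<close>, integrated against \<open>c k\<close>, is a Lipschitz bound for
  the component \<open>k\<close> of \<open>a \<mapsto> stiffness a *v a\<close>.\<close>

lemma stiffness_increment_le:
  "\<bar>(stiffness a *v a - stiffness b *v b) $ k\<bar>
     \<le> (\<Sum>j\<in>UNIV. \<bar>a $ j - b $ j\<bar> * (3 * L * (LINT \<xi>:\<Omega>|lebesgue. norm (c j \<xi>) * norm (c k \<xi>))))"
proof -
  let ?H = "\<lambda>a \<xi>. \<nu> \<xi> (strength a \<xi>) * (fe_field c a \<xi> \<bullet> c k \<xi>)"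
  let ?N = "\<lambda>\<xi>. \<Sum>j\<in>UNIV. (\<bar>a $ j - b $ j\<bar> * (3 * L)) * (norm (c j \<xi>) * norm (c k \<xi>))"
  have comp: "(stiffness a *v a) $ k = (LINT \<xi>:\<Omega>|lebesgue. ?H a \<xi>)" for a
    using stiffness_form[of "axis k 1" a] by (simp add: inner_axis' fe_field_axis)
  have int: "set_integrable lebesgue \<Omega> (?H a)" for a
    using stiffness_form_integrable[of a "axis k 1"] by (simp add: fe_field_axis)
  have intN: "set_integrable lebesgue \<Omega> (\<lambda>\<xi>. (\<bar>a $ j - b $ j\<bar> * (3 * L)) * (norm (c j \<xi>) * norm (c k \<xi>)))" for j
    by (intro set_integrable_mult_right L2_on_norm_mult_integrable L2)
  have L: "0 \<le> L" using reluctivity_bounds[of undefined undefined] by linarith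
  have le: "\<bar>?H a \<xi> - ?H b \<xi>\<bar> \<le> ?N \<xi>" if \<xi>: "\<xi> \<in> \<Omega>" for \<xi>
  proof -
    have "\<bar>?H a \<xi> - ?H b \<xi>\<bar> = \<bar>(\<nu> \<xi> (norm (fe_field c a \<xi>)) *\<^sub>R fe_field c a \<xi> - \<nu> \<xi> (norm (fe_field c b \<xi>)) *\<^sub>R fe_field c b \<xi>) \<bullet> c k \<xi>\<bar>"
      using \<xi> by (simp add: strength_def inner_diff_left)
    also have "\<dots> \<le> norm (\<nu> \<xi> (norm (fe_field c a \<xi>)) *\<^sub>R fe_field c a \<xi> - \<nu> \<xi> (norm (fe_field c b \<xi>)) *\<^sub>R fe_field c b \<xi>) * norm (c k \<xi>)"
      by (rule Cauchy_Schwarz_ineq2)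
    also have "\<dots> \<le> (3 * L * norm (fe_field c (a - b) \<xi>)) * norm (c k \<xi>)"
      unfolding fe_field_diff by (intro mult_right_mono magnetic_field_lipschitz[OF law]) simp
    also have "\<dots> \<le> (3 * L * (\<Sum>j\<in>UNIV. norm ((a - b) $ j *\<^sub>R c j \<xi>))) * norm (c k \<xi>)"
      unfolding fe_field_def using L by (intro mult_right_mono mult_left_mono norm_sum) auto
    also have "\<dots> = ?N \<xi>"
      by (simp add: sum_distrib_left sum_distrib_right mult_ac)
    finally show ?thesis .
  qed
  have "\<bar>(stiffness a *v a - stiffness b *v b) $ k\<bar> = \<bar>LINT \<xi>:\<Omega>|lebesgue. ?H a \<xi> - ?H b \<xi>\<bar>"
    by (simp only: vector_minus_component comp set_integral_diff(2)[OF int int])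
  also have "\<dots> \<le> (LINT \<xi>:\<Omega>|lebesgue. ?N \<xi>)"
  proof (rule abs_leI)
    have "set_integrable lebesgue \<Omega> (\<lambda>\<xi>. ?H a \<xi> - ?H b \<xi>)" for a b by (intro set_integral_diff int)
    moreover have "set_integrable lebesgue \<Omega> ?N" by (rule set_lebesgue_integral_sum(1)[OF _ intN]) simp
    ultimately have mono: "(LINT \<xi>:\<Omega>|lebesgue. ?H a' \<xi> - ?H b' \<xi>) \<le> (LINT \<xi>:\<Omega>|lebesgue. ?N \<xi>)"
      if "\<And>\<xi>. \<xi> \<in> \<Omega> \<Longrightarrow> ?H a' \<xi> - ?H b' \<xi> \<le> ?N \<xi>" for a' b'
      by (rule set_integral_mono[OF _ _ that])
    show "(LINT \<xi>:\<Omega>|lebesgue. ?H a \<xi> - ?H b \<xi>) \<le> (LINT \<xi>:\<Omega>|lebesgue. ?N \<xi>)"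
      by (rule mono) (use le in \<open>auto simp: abs_le_iff\<close>)
    have "- (LINT \<xi>:\<Omega>|lebesgue. ?H a \<xi> - ?H b \<xi>) = (LINT \<xi>:\<Omega>|lebesgue. ?H b \<xi> - ?H a \<xi>)"
      by (simp only: set_integral_diff(2)[OF int int] minus_diff_eq)
    also have "\<dots> \<le> (LINT \<xi>:\<Omega>|lebesgue. ?N \<xi>)"
      by (rule mono) (use le in \<open>auto simp: abs_le_iff\<close>)
    finally show "- (LINT \<xi>:\<Omega>|lebesgue. ?H a \<xi> - ?H b \<xi>) \<le> (LINT \<xi>:\<Omega>|lebesgue. ?N \<xi>)" .
  qed
  also have "\<dots> = (\<Sum>j\<in>UNIV. \<bar>a $ j - b $ j\<bar> * (3 * L * (LINT \<xi>:\<Omega>|lebesgue. norm (c j \<xi>) * norm (c k \<xi>))))"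
    by (subst set_lebesgue_integral_sum(2)[OF _ intN]) (simp_all add: mult.assoc)
  finally show ?thesis .
qed

lemma continuous_stiffness: "continuous_on UNIV (\<lambda>a. stiffness a *v a)"
proof (intro continuous_at_imp_continuous_on ballI)
  fix a
  have "((\<lambda>b. stiffness b *v b) \<longlongrightarrow> stiffness a *v a) (at a)"
  proof (rule vec_tendstoI)
    fix k
    let ?C = "\<lambda>j. 3 * L * (LINT \<xi>:\<Omega>|lebesgue. norm (c j \<xi>) * norm (c k \<xi>))"
    have "((\<lambda>b. \<Sum>j\<in>UNIV. \<bar>b $ j - a $ j\<bar> * ?C j) \<longlongrightarrow> (\<Sum>j\<in>UNIV. \<bar>a $ j - a $ j\<bar> * ?C j)) (at a)"
      by (intro tendsto_intros)
    hence lim: "((\<lambda>b. \<Sum>j\<in>UNIV. \<bar>b $ j - a $ j\<bar> * ?C j) \<longlongrightarrow> 0) (at a)" by simp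
    have "((\<lambda>b. (stiffness b *v b) $ k - (stiffness a *v a) $ k) \<longlongrightarrow> 0) (at a)"
      by (rule Lim_null_comparison[OF _ lim])
        (use stiffness_increment_le[of _ a k] in \<open>simp only: real_norm_def vector_minus_component eventually_True\<close>)
    thus "((\<lambda>b. (stiffness b *v b) $ k) \<longlongrightarrow> (stiffness a *v a) $ k) (at a)"
      by (simp add: LIM_zero_iff)
  qed
  thus "isCont (\<lambda>a. stiffness a *v a) a" by (simp add: isCont_def)
qed

end

section \<open>Edge elements on the mesh\<close>

text \<open>The Lebesgue measure is complete, so either both functions are measurable, or both integrals have
  the default value 0. This is applied to integrands with the pointwise curl of a combination,
  which is under control only off the faces of the mesh.\<close>

lemma lebesgue_integral_cong_AE:
  fixes f g :: "'a::euclidean_space \<Rightarrow> 'b::euclidean_space"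
  assumes eq: "AE x in lebesgue. f x = g x"
  shows "integral\<^sup>L lebesgue f = integral\<^sup>L lebesgue g"
proof (cases "f \<in> borel_measurable lebesgue")
  case True
  show ?thesis using integral_cong_AE[OF True borel_measurable_AE[OF True eq] eq] .
next
  case False
  have eq': "AE x in lebesgue. g x = f x" using eq by eventually_elim (rule sym)
  have "g \<notin> borel_measurable lebesgue" using False borel_measurable_AE[OF _ eq'] by blast
  hence "\<not> integrable lebesgue f" "\<not> integrable lebesgue g"
    using False borel_measurable_integrable by blast+
  thus ?thesis by (simp add: not_integrable_integral_eq)
qed

lemma curl_sum_scaleR:
  assumes diff: "\<And>k. \<phi> k differentiable (at \<xi>)"
  shows "curl (\<lambda>\<eta>. \<Sum>k\<in>UNIV. a $ k *\<^sub>R \<phi> k \<eta>) \<xi> = fe_field (\<lambda>k. curl (\<phi> k)) a \<xi>"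
proof -
  have "((\<lambda>\<eta>. \<Sum>k\<in>UNIV. a $ k *\<^sub>R \<phi> k \<eta>) has_derivative
      (\<lambda>h. \<Sum>k\<in>UNIV. a $ k *\<^sub>R frechet_derivative (\<phi> k) (at \<xi>) h)) (at \<xi>)"
    using diff by (intro has_derivative_sum has_derivative_scaleR_right) (simp add: frechet_derivative_works)
  hence "frechet_derivative (\<lambda>\<eta>. \<Sum>k\<in>UNIV. a $ k *\<^sub>R \<phi> k \<eta>) (at \<xi>)
      = (\<lambda>h. \<Sum>k\<in>UNIV. a $ k *\<^sub>R frechet_derivative (\<phi> k) (at \<xi>) h)"
    by (rule frechet_derivative_at[symmetric])
  hence "partial_comp i j (\<lambda>\<eta>. \<Sum>k\<in>UNIV. a $ k *\<^sub>R \<phi> k \<eta>) \<xi>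
      = (\<Sum>k\<in>UNIV. a $ k * partial_comp i j (\<phi> k) \<xi>)" for i j
    by (simp add: partial_comp_def)
  thus ?thesis
    by (simp add: fe_field_def curl_def vec_eq_iff forall_3 right_diff_distrib sum_subtractf)
qed

text \<open>The points left out lie on the boundaries of finitely many simplices, which are convex and so have
  negligible boundary.\<close>

lemma AE_interior_of_mesh:
  assumes "regular_tetrahedral_mesh \<Omega> \<T>"
  shows "AE \<xi> in lebesgue. \<xi> \<in> \<Omega> \<longrightarrow> (\<exists>T\<in>\<T>. \<xi> \<in> interior T)"
proof -
  have fin: "finite \<T>" and simp: "\<And>T. T \<in> \<T> \<Longrightarrow> 3 simplex T" and cover: "\<Union>\<T> = closure \<Omega>"
    using assms by (auto simp: regular_tetrahedral_mesh_def triangulation_def)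
  have "negligible (\<Union>T\<in>\<T>. frontier T)"
    using fin simp by (intro negligible_Union) (auto intro: negligible_convex_frontier convex_simplex)
  hence "AE \<xi> in lebesgue. \<xi> \<notin> (\<Union>T\<in>\<T>. frontier T)"
    by (intro AE_not_in) (simp add: negligible_iff_null_sets)
  thus ?thesis
  proof (rule AE_mp, intro AE_I2 impI)
    fix \<xi> assume out: "\<xi> \<notin> (\<Union>T\<in>\<T>. frontier T)" and "\<xi> \<in> \<Omega>"
    then obtain T where "T \<in> \<T>" "\<xi> \<in> T" using cover closure_subset by blast
    with out show "\<exists>T\<in>\<T>. \<xi> \<in> interior T"
      using closure_subset[of T] by (auto simp: frontier_def intro!: bexI[of _ T])
  qed
qed

lemma nedelec_edge_basis_differentiable:
  assumes basis: "nedelec_edge_basis \<Omega> \<T> p q \<phi>" and T: "T \<in> \<T>" "\<xi> \<in> interior T"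
  shows "\<phi> k differentiable (at \<xi>)"
proof -
  obtain \<alpha> \<beta> where eq: "\<And>\<xi>. \<xi> \<in> interior T \<Longrightarrow> \<phi> k \<xi> = \<alpha> + cross3 \<beta> \<xi>"
    using basis T(1) unfolding nedelec_edge_basis_def by metis
  have "linear (cross3 \<beta>)"
    by (rule linearI) (simp_all add: cross_add_right cross_mult_right)
  hence "(\<lambda>\<xi>. \<alpha> + cross3 \<beta> \<xi>) differentiable (at \<xi>)"
    by (intro differentiable_add differentiable_const linear_imp_differentiable)
  then obtain D where D: "((\<lambda>\<xi>. \<alpha> + cross3 \<beta> \<xi>) has_derivative D) (at \<xi>)"
    unfolding differentiable_def ..
  have "(\<phi> k has_derivative D) (at \<xi>)"
    by (rule has_derivative_transform_within_open[OF D open_interior T(2)]) (simp only: eq)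
  thus ?thesis by (rule differentiableI)
qed

text \<open>Almost everywhere in \<open>\<Omega>\<close> the basis functions are affine near the point, so the pointwise curl of
  their combination is the combination of the curls, and the weight takes the form of the general
  energy.\<close>

lemma stiffness_matrix_eq_mass_matrix:
  assumes mesh: "regular_tetrahedral_mesh \<Omega> \<T>" and basis: "nedelec_edge_basis \<Omega> \<T> p q \<phi>"
  shows "stiffness_matrix \<Omega> \<nu> \<phi> a
    = mass_matrix \<Omega> (\<lambda>\<xi>. \<nu> \<xi> (norm (fe_field (\<lambda>k. curl (\<phi> k)) a \<xi>))) (\<lambda>k. curl (\<phi> k))"
proof -
  have "AE \<xi> in lebesgue. \<xi> \<in> \<Omega> \<longrightarrow>
      curl (\<lambda>\<eta>. \<Sum>j\<in>UNIV. a $ j *\<^sub>R \<phi> j \<eta>) \<xi> = fe_field (\<lambda>k. curl (\<phi> k)) a \<xi>"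
    using AE_interior_of_mesh[OF mesh]
  proof eventually_elim
    case (elim \<xi>)
    show ?case
    proof
      assume "\<xi> \<in> \<Omega>"
      with elim obtain T where "T \<in> \<T>" "\<xi> \<in> interior T" by blast
      thus "curl (\<lambda>\<eta>. \<Sum>j\<in>UNIV. a $ j *\<^sub>R \<phi> j \<eta>) \<xi> = fe_field (\<lambda>k. curl (\<phi> k)) a \<xi>"
        by (intro curl_sum_scaleR nedelec_edge_basis_differentiable[OF basis])
    qed
  qed
  hence "AE \<xi> in lebesgue. indicator \<Omega> \<xi> *\<^sub>R (\<nu> \<xi> (norm (curl (\<lambda>\<eta>. \<Sum>j\<in>UNIV. a $ j *\<^sub>R \<phi> j \<eta>) \<xi>)) * (curl (\<phi> l) \<xi> \<bullet> curl (\<phi> k) \<xi>))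
      = indicator \<Omega> \<xi> *\<^sub>R (\<nu> \<xi> (norm (fe_field (\<lambda>k. curl (\<phi> k)) a \<xi>)) * (curl (\<phi> l) \<xi> \<bullet> curl (\<phi> k) \<xi>))" for k l
  proof eventually_elim
    case (elim \<xi>)
    thus ?case by (cases "\<xi> \<in> \<Omega>") simp_all
  qed
  hence "(LINT \<xi>:\<Omega>|lebesgue. \<nu> \<xi> (norm (curl (\<lambda>\<eta>. \<Sum>j\<in>UNIV. a $ j *\<^sub>R \<phi> j \<eta>) \<xi>)) * (curl (\<phi> l) \<xi> \<bullet> curl (\<phi> k) \<xi>))
      = (LINT \<xi>:\<Omega>|lebesgue. \<nu> \<xi> (norm (fe_field (\<lambda>k. curl (\<phi> k)) a \<xi>)) * (curl (\<phi> l) \<xi> \<bullet> curl (\<phi> k) \<xi>))" for k l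
    unfolding set_lebesgue_integral_def by (rule lebesgue_integral_cong_AE)
  thus ?thesis by (simp add: stiffness_matrix_def mass_matrix_def)
qed

text \<open>At each point the reluctivity is the law of the conductor, the constant \<open>\<nu>I\<close>, or zero, the last
  off both regions and in particular on their interface. The constant \<open>max L \<nu>I\<close> serves all three.\<close>

lemma magnetic_energy_reluctivity:
  assumes law: "magnetic_law L \<nu>C" and \<nu>C: "\<nu>C \<in> borel_measurable (restrict_space borel {0..})"
    and \<nu>I: "0 \<le> \<nu>I" and sets: "open \<Omega>C" "open \<Omega>I" "\<Omega>C \<inter> \<Omega>I = {}" and c: "\<And>k. L2_on \<Omega> (c k)"
  shows "magnetic_energy \<Omega> (reluctivity \<Omega>C \<Omega>I \<nu>C \<nu>I) (max L \<nu>I) c"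
proof
  have cases: "reluctivity \<Omega>C \<Omega>I \<nu>C \<nu>I \<xi> = (if \<xi> \<in> \<Omega>C then \<nu>C else if \<xi> \<in> \<Omega>I then (\<lambda>_. \<nu>I) else (\<lambda>_. 0))" for \<xi>
    using sets(3) by (auto simp: reluctivity_def fun_eq_iff indicator_def)
  have [measurable]: "\<Omega>C \<in> sets lebesgue" "\<Omega>I \<in> sets lebesgue" using sets by auto
  have L: "0 \<le> L" using law by (auto simp: magnetic_law_def intro: order_trans)
  show "magnetic_law (max L \<nu>I) (reluctivity \<Omega>C \<Omega>I \<nu>C \<nu>I \<xi>)" for \<xi>
    unfolding cases
    using magnetic_law_mono[OF law, of "max L \<nu>I"] magnetic_law_mono[OF magnetic_law_const[OF \<nu>I], of "max L \<nu>I"]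
      magnetic_law_mono[OF magnetic_law_const[of 0], of "max L \<nu>I"] L by auto
  show "(\<lambda>\<xi>. reluctivity \<Omega>C \<Omega>I \<nu>C \<nu>I \<xi> (r \<xi>)) \<in> borel_measurable lebesgue"
    if r: "r \<in> borel_measurable lebesgue" "\<And>\<xi>. 0 \<le> r \<xi>" for r
  proof -
    have "r \<in> measurable lebesgue (restrict_space borel {0..})"
      using r by (intro measurable_restrict_space2) auto
    from measurable_compose[OF this \<nu>C] have [measurable]: "(\<lambda>\<xi>. \<nu>C (r \<xi>)) \<in> borel_measurable lebesgue" .
    show ?thesis unfolding reluctivity_def by measurable
  qed
  show "(\<lambda>\<xi>. energy_density (reluctivity \<Omega>C \<Omega>I \<nu>C \<nu>I \<xi>) (r \<xi>)) \<in> borel_measurable lebesgue"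
    if r: "r \<in> borel_measurable lebesgue" for r
  proof -
    have *: "(\<lambda>\<xi>. energy_density \<nu> (r \<xi>)) \<in> borel_measurable lebesgue" if "magnetic_law L' \<nu>" for L' \<nu>
      using measurable_compose[OF r energy_density_measurable[OF that]] .
    note [measurable] = *[OF law] *[OF magnetic_law_const[OF \<nu>I]] *[OF magnetic_law_const[of 0, OF order_refl]]
    have "(\<lambda>\<xi>. energy_density (reluctivity \<Omega>C \<Omega>I \<nu>C \<nu>I \<xi>) (r \<xi>)) = (\<lambda>\<xi>. if \<xi> \<in> \<Omega>C then energy_density \<nu>C (r \<xi>)
        else if \<xi> \<in> \<Omega>I then energy_density (\<lambda>_. \<nu>I) (r \<xi>) else energy_density (\<lambda>_. 0) (r \<xi>))"
      by (auto simp: cases fun_eq_iff)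
    thus ?thesis by simp
  qed
qed (rule c)

section \<open>Passivity of the semidiscretized system\<close>

theorem theorem7:
  fixes \<Omega> \<Omega>C \<Omega>I :: "(real^3) set"
    and \<T> :: "(real^3) set set"
    and \<sigma>C \<nu>I m\<nu> L\<nu> :: real
    and \<nu>C :: "real \<Rightarrow> real"
    and R :: "real^'m^'m"
    and ch :: "'m::finite \<Rightarrow> real^3 \<Rightarrow> real^3"
    and p q :: "'c::finite + 'd::finite \<Rightarrow> real^3"
    and \<phi> :: "'c + 'd \<Rightarrow> real^3 \<Rightarrow> real^3"
    and M :: "real^('c + 'd)^('c + 'd)"
    and K :: "real^('c + 'd) \<Rightarrow> real^('c + 'd)^('c + 'd)"
    and X :: "real^'m^('c + 'd)"
  assumes "bounded_lipschitz_domain \<Omega>" and "simply_connected \<Omega>"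
    and "conducting_decomposition \<Omega> \<Omega>C \<Omega>I"
    and "\<sigma>C > 0" and "\<nu>I > 0"
    and "\<forall>\<zeta>\<ge>0. \<nu>C \<zeta> \<ge> 0"
    and "\<nu>C \<in> borel_measurable (restrict_space borel {0..})"
    and "m\<nu> > 0" and "strongly_monotone_on m\<nu> {0..} (\<lambda>\<zeta>. \<nu>C \<zeta> * \<zeta>)"
    and "L\<nu> > 0" and "L\<nu>-lipschitz_on {0..} (\<lambda>\<zeta>. \<nu>C \<zeta> * \<zeta>)"
    and "sym_pos_def R"
    and "winding_function \<Omega> ch"
    and "regular_tetrahedral_mesh \<Omega> \<T>"
    and "nedelec_edge_basis \<Omega> \<T> p q \<phi>"
    and "conductor_ordering \<Omega>C \<phi>"
    and "M = mass_matrix \<Omega> (conductivity \<Omega>C \<sigma>C) \<phi>"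
    and "K = stiffness_matrix \<Omega> (reluctivity \<Omega>C \<Omega>I \<nu>C \<nu>I) \<phi>"
    and "X = winding_matrix \<Omega> ch \<phi>"
    and "sym_pos_def (upper_left_block M)"
    and "rank (lower_rows X) = CARD('m)"
  shows "is_passive (E_FE M X) (\<lambda>x. A_FE K X R x *v x) B_FE (\<lambda>x. transpose B_FE *v x)"
proof -
  let ?\<nu> = "reluctivity \<Omega>C \<Omega>I \<nu>C \<nu>I" and ?c = "\<lambda>k. curl (\<phi> k)"
  have sets: "open \<Omega>C" "open \<Omega>I" "\<Omega>C \<inter> \<Omega>I = {}"
    using assms(1,3) closure_subset[of \<Omega>C]
    by (auto simp: conducting_decomposition_def bounded_lipschitz_domain_def)
  have L2_basis: "L2_on \<Omega> (\<phi> k)" "L2_on \<Omega> (?c k)" for k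
    using assms(15) by (auto simp: nedelec_edge_basis_def H0_curl_def)
  interpret magnetic_energy \<Omega> ?\<nu> "max (max L\<nu> (\<nu>C 0)) \<nu>I" ?c
    by (rule magnetic_energy_reluctivity[OF magnetic_law_strongly_monotone[OF assms(6,8,9,11)] assms(7)
          less_imp_le[OF assms(5)] sets L2_basis(2)])
  have K: "K = stiffness"
    unfolding assms(18) stiffness_def by (rule ext) (rule stiffness_matrix_eq_mass_matrix[OF assms(14,15)])
  have \<Omega>C: "\<Omega>C \<in> sets lebesgue" using sets(1) by auto
  have "conductivity \<Omega>C \<sigma>C \<in> borel_measurable lebesgue"
    unfolding conductivity_def[abs_def] using \<Omega>C by measurable
  moreover have "0 \<le> conductivity \<Omega>C \<sigma>C \<xi> \<and> conductivity \<Omega>C \<sigma>C \<xi> \<le> \<sigma>C" for \<xi>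
    using assms(4) by (simp add: conductivity_def indicator_def)
  ultimately have M_nonneg: "0 \<le> z \<bullet> (M *v z)" for z
    unfolding assms(17) by (rule mass_matrix_nonneg[OF L2_basis(1)])
  have M_sym: "transpose M = M" unfolding assms(17) by (rule transpose_mass_matrix)
  have R_nonneg: "0 \<le> z \<bullet> (R *v z)" for z
    using assms(12) by (cases "z = 0") (auto simp: sym_pos_def_def less_imp_le)
  show ?thesis
    unfolding K
    by (rule passive_if_convex_energy[OF M_sym M_nonneg R_nonneg energy_nonneg energy_subgradient
          continuous_stiffness])
qed

end
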